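(* Assume $\|X-\pi_\gamma(X)\|\le B<\tau_\gamma$ almost surely with $B=(1/2-q)\tau_\gamma$ for some $q>0$, and choose any $\eta\in(2B,\tau_\gamma)$. Let $\{\bar x_i:i\in[N]\}\subset\operatorname{supp}(\rho_X)$ and $\{\hat a(\bar x_i):i\in[N]\}\subset\mathbb S^{D-1}$ be arbitrary sets. For arbitrary $x\in\operatorname{supp}(\rho_X)$ let $\bar x_{k(x)}$ be its $k$-th closest sample based on $\Delta_\eta(x,\cdot)$, and $\bar x_{k^*(x)}$ its $k$-th closest sample based on $d_\gamma(x,\cdot)$. Whenever $\{\pi_\gamma(\bar x_i):i\in[N]\}$ forms a $\delta$-net on $\operatorname{Im}(\gamma)$ and $$\delta k<\min\left\{\eta-2B,\ \frac12\Bigl(q\tau_\gamma-(\tau_\gamma+|\mathcal I|+2B)\max_{i\in[N]}\|\hat a(\bar x_i)-a(\bar x_i)\|\Bigr)\right\},$$ we have $$d_\gamma(x,\bar x_{k(x)})\le4\bigl(2\vee(|\mathcal I|+2B)\vee\tau_\gamma\bigr)\left(d_\gamma(x,\bar x_{k^*(x)})+\max_{i\in[N]}\|\hat a(\bar x_i)-a(\bar x_i)\|\right).$$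
   Context: $\gamma:\mathcal I\to\mathbb R^D$ ($\mathcal I$ a closed interval of length $|\mathcal I|$) is an arc-length parametrization of a simple connected $C^2$ curve $\operatorname{Im}(\gamma)$ with $\kappa=\|\gamma''\|_\infty<\infty$. $\pi_\gamma(x)\in\arg\min_{z\in\operatorname{Im}(\gamma)}\|x-z\|$ is the orthogonal projection; the reach $\tau_\gamma$ is the largest $r>0$ such that every point at distance less than $r$ from $\operatorname{Im}(\gamma)$ has a unique nearest point on $\operatorname{Im}(\gamma)$. $d_\gamma(\gamma(t_1),\gamma(t_2))=|t_1-t_2|$, extended by $d_\gamma(x,x')=d_\gamma(\pi_\gamma(x),\pi_\gamma(x'))$. $\rho_X$ is the law of the random vector $X$ in $\mathbb R^D$; the component $x-\pi_\gamma(x)$ is orthogonal to the tangent $a(x):=\gamma'(\gamma^{-1}(\pi_\gamma(x)))$. The proxy metric with restricting radius $\eta$ is $\Delta_\eta(x,\bar x_i)=|\hat a(\bar x_i)^\top(x-\bar x_i)|$ if $\|x-\bar x_i\|\le\eta$, and $\Delta_\eta(x,\bar x_i)=\infty$ otherwise. A $\delta$-net on $\operatorname{Im}(\gamma)$ is a set such that every point of $\operatorname{Im}(\gamma)$ is within $d_\gamma$-distance $\delta$ of one of its elements. $a\vee b=\max\{a,b\}$, $[N]=\{1,\dots,N\}$, $\mathbb S^{D-1}$ is the unit sphere, $1\le k\le N$; ties in the orderings are broken arbitrarily.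
   Formalization: The k-th closest sample based on Δ_η is required to have Δ_η < ∞; if fewer than k samples lie within radius η of x (possible near an end of the curve), breaking ties at ∞ arbitrarily makes the claim false. *)

theory Defs
  imports "HOL-Probability.Probability"
begin

definition velocity :: "real \<Rightarrow> real \<Rightarrow> (real \<Rightarrow> 'a::real_normed_vector) \<Rightarrow> real \<Rightarrow> 'a" where
  "velocity a b \<gamma> t = vector_derivative \<gamma> (at t within {a..b})"

text \<open>
  Derivatives are one-sided at the end points. Boundedness of the second derivative
  is automatic, since it is continuous on the compact interval.
\<close>

definition simple_C2_arclength_curve :: "real \<Rightarrow> real \<Rightarrow> (real \<Rightarrow> 'a::real_normed_vector) \<Rightarrow> bool" where
  "simple_C2_arclength_curve a b \<gamma> \<longleftrightarrow>
     a < b \<and> inj_on \<gamma> {a..b} \<and>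
     (\<forall>t\<in>{a..b}. \<gamma> differentiable (at t within {a..b})) \<and>
     (\<forall>t\<in>{a..b}. norm (velocity a b \<gamma> t) = 1) \<and>
     (\<forall>t\<in>{a..b}. velocity a b \<gamma> differentiable (at t within {a..b})) \<and>
     continuous_on {a..b} (velocity a b (velocity a b \<gamma>))"

text \<open>
  The radii with the unique-projection property are closed under suprema, so the
  supremum is the largest such radius. It is infinite, e.g., for a line segment.
\<close>

definition reach :: "'a::metric_space set \<Rightarrow> ereal" where
  "reach S = Sup {ereal r | r. 0 < r \<and>
     (\<forall>x. infdist x S < r \<longrightarrow> (\<exists>!z. is_arg_min (dist x) (\<lambda>z. z \<in> S) z))}"

definition supp :: "'a::topological_space measure \<Rightarrow> 'a set" where
  "supp \<rho> = {x. \<forall>U. open U \<longrightarrow> x \<in> U \<longrightarrow> 0 < emeasure \<rho> U}"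

definition proj :: "real \<Rightarrow> real \<Rightarrow> (real \<Rightarrow> 'a::euclidean_space) \<Rightarrow> 'a \<Rightarrow> 'a" where
  "proj a b \<gamma> x = closest_point (\<gamma> ` {a..b}) x"

definition param :: "real \<Rightarrow> real \<Rightarrow> (real \<Rightarrow> 'a) \<Rightarrow> 'a \<Rightarrow> real" where
  "param a b \<gamma> = the_inv_into {a..b} \<gamma>"

definition tangent :: "real \<Rightarrow> real \<Rightarrow> (real \<Rightarrow> 'a::euclidean_space) \<Rightarrow> 'a \<Rightarrow> 'a" where
  "tangent a b \<gamma> x = velocity a b \<gamma> (param a b \<gamma> (proj a b \<gamma> x))"

text \<open>
  The distance along the curve, for arbitrary points of the ambient space. A point of
  the curve is its own projection, so that \<open>curve_dist a b \<gamma> (\<gamma> s) (\<gamma> t) = \<bar>s - t\<bar>\<close>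
  for \<open>s\<close> and \<open>t\<close> in \<open>{a..b}\<close>.
\<close>

definition curve_dist :: "real \<Rightarrow> real \<Rightarrow> (real \<Rightarrow> 'a::euclidean_space) \<Rightarrow> 'a \<Rightarrow> 'a \<Rightarrow> real" where
  "curve_dist a b \<gamma> x y = \<bar>param a b \<gamma> (proj a b \<gamma> x) - param a b \<gamma> (proj a b \<gamma> y)\<bar>"

definition is_net :: "real \<Rightarrow> real \<Rightarrow> (real \<Rightarrow> 'a::euclidean_space) \<Rightarrow> real \<Rightarrow> 'a set \<Rightarrow> bool" where
  "is_net a b \<gamma> \<delta> S \<longleftrightarrow>
     S \<subseteq> \<gamma> ` {a..b} \<and> (\<forall>y\<in>\<gamma> ` {a..b}. \<exists>z\<in>S. curve_dist a b \<gamma> y z \<le> \<delta>)"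

definition proxy_dist :: "real \<Rightarrow> ('a::euclidean_space \<Rightarrow> 'a) \<Rightarrow> 'a \<Rightarrow> 'a \<Rightarrow> ereal" where
  "proxy_dist \<eta> ahat x y = (if norm (x - y) \<le> \<eta> then ereal \<bar>ahat y \<bullet> (x - y)\<bar> else \<infinity>)"

text \<open>
  Sample \<open>i\<close> is in position \<open>k\<close> when the samples \<open>1, \<dots>, N\<close> are listed by increasing
  distance \<open>f\<close>; any ordering \<open>\<sigma>\<close> is admitted, so ties are broken arbitrarily.
  A sample at infinite distance is not regarded as a neighbour: if fewer than \<open>k\<close>
  samples have finite distance, there is no \<open>k\<close>-th closest sample. The distance
  \<open>proxy_dist\<close> is infinite outside the restricting radius and carries no
  information there; letting ties at \<open>\<infinity>\<close> be broken arbitrarily would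
  let any sample outside the radius be selected.
\<close>

definition kth_closest :: "nat \<Rightarrow> (nat \<Rightarrow> ereal) \<Rightarrow> nat \<Rightarrow> nat \<Rightarrow> bool" where
  "kth_closest N f k i \<longleftrightarrow>
     (\<exists>\<sigma>. bij_betw \<sigma> {1..N} {1..N} \<and> mono_on {1..N} (\<lambda>m. f (\<sigma> m)) \<and> i = \<sigma> k) \<and> f i < \<infinity>"

end

theory Submission
  imports Defs
begin

text \<open>
  Inside the tube of radius \<open>\<tau>\<close> the projection \<open>\<pi>\<close> satisfies Federer's inequality
  \<open>2 \<tau> (z - \<pi> x) \<bullet> (x - \<pi> x) \<le> \<parallel>x - \<pi> x\<parallel> \<parallel>z - \<pi> x\<parallel>\<^sup>2\<close>; a Brouwer argument gives it directly from uniqueness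
  of nearest points. It makes \<open>\<pi>\<close> Lipschitz, bounds the curvature by \<open>1 / \<tau>\<close>, and confines
  the curve to the outside of its tangent balls of radius \<open>\<tau>\<close>.

  If the \<open>k\<close> samples nearest along the curve all lie within radius \<open>\<eta>\<close>, the proxy distance of the
  selected sample \<open>y\<close> is small, so \<open>x\<close> is close to the normal space at \<open>\<pi> y\<close>.
  The tangent balls then force \<open>x\<close> to be close to \<open>y\<close> along the curve, where
  the proxy distance dominates half of the curve distance, up to the tangent error.
  If one of them lies outside radius \<open>\<eta>\<close>, their curve distances are already of order \<open>\<eta>\<close>. The \<open>k\<close>-th sample
  is only within \<open>2 \<delta> k\<close> (not \<open>\<delta> k\<close>) in general, for instance at an end of the curve.
\<close>

subsection \<open>Sets of positive reach\<close>

lemma closest_point_dist_infdist: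
  fixes S :: "'a::euclidean_space set"
  assumes "closed S" "S \<noteq> {}"
  shows "dist x (closest_point S x) = infdist x S"
proof (rule antisym)
  show "dist x (closest_point S x) \<le> infdist x S"
    using assms by (simp add: infdist_notempty cINF_greatest closest_point_le)
  show "infdist x S \<le> dist x (closest_point S x)"
    using assms by (simp add: closest_point_in_set infdist_le)
qed

text \<open>A distance strictly below the supremum lies below some admissible radius, so the choice
  made by \<open>closest_point\<close> agrees with every minimiser.\<close>

lemma closest_point_unique_reach:
  fixes S :: "'a::euclidean_space set"
  assumes "closed S" "infdist x S < reach S" "z \<in> S" "dist x z \<le> infdist x S"
  shows "closest_point S x = z"
proof -
  have ne: "S \<noteq> {}" using assms by auto
  obtain r where "infdist x S < r"
      "\<And>x. infdist x S < r \<Longrightarrow> \<exists>!z. is_arg_min (dist x) (\<lambda>z. z \<in> S) z"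
    using assms(2) unfolding reach_def less_Sup_iff by auto
  then have ex1: "\<exists>!z. is_arg_min (dist x) (\<lambda>z. z \<in> S) z" by blast
  have "is_arg_min (dist x) (\<lambda>z. z \<in> S) w" if "w \<in> S" "dist x w \<le> infdist x S" for w
    unfolding is_arg_min_def using that infdist_le[of _ S x] by force
  with ex1 assms(3,4) show ?thesis
    using closest_point_in_set[OF assms(1) ne, of x] closest_point_dist_infdist[OF assms(1) ne, of x]
    by (metis order_refl)
qed

text \<open>By uniqueness the graph is cut out by the closed condition
  \<open>dist x z \<le> infdist x S\<close>; a map into a compact set with closed graph is
  continuous.\<close>

lemma continuous_on_closest_point_reach:
  fixes S :: "'a::euclidean_space set"
  assumes "compact S" "S \<noteq> {}" "\<And>x. x \<in> A \<Longrightarrow> infdist x S < reach S"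
  shows "continuous_on A (closest_point S)"
proof -
  have cl: "closed S" using assms(1) by (rule compact_imp_closed)
  have maps: "closest_point S \<in> A \<rightarrow> S" using closest_point_in_set[OF cl assms(2)] by auto
  have eq: "(\<lambda>x. (x, closest_point S x)) ` A
      = (A \<times> S) \<inter> {u. dist (fst u) (snd u) \<le> infdist (fst u) S}"
    using closest_point_in_set[OF cl assms(2)] closest_point_dist_infdist[OF cl assms(2)]
      closest_point_unique_reach[OF cl assms(3)] by (force simp: image_iff)
  show ?thesis
    unfolding continuous_closed_graph_eq[OF assms(1) maps] eq
    by (intro closedin_closed_Int closed_Collect_le continuous_intros)
qed

text \<open>
  The map pushes \<open>x\<close> away from the nearest point of its argument. So \<open>x\<close> lies between a Brouwer
  fixed point \<open>w\<close> and the nearest point of \<open>w\<close>, which is therefore also the nearest point of \<open>x\<close>.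
\<close>

lemma closest_point_extend_ray:
  fixes S :: "'a::euclidean_space set"
  assumes S: "compact S" and x: "x \<notin> S" and e: "0 \<le> e" "infdist x S + e < reach S"
  defines "p \<equiv> closest_point S x"
  assumes z: "z \<in> S"
  shows "infdist x S + e \<le> dist (x + (e / norm (x - p)) *\<^sub>R (x - p)) z"
proof -
  have ne: "S \<noteq> {}" using z by auto
  have cl: "closed S" using S by (rule compact_imp_closed)
  define f where "f z = x + (e / norm (x - closest_point S z)) *\<^sub>R (x - closest_point S z)" for z
  have nz: "x \<noteq> closest_point S z" for z
    using closest_point_in_set[OF cl ne, of z] x by auto
  have cont: "continuous_on (cball x e) (closest_point S)"
  proof (rule continuous_on_closest_point_reach[OF S ne])
    fix w assume "w \<in> cball x e"
    then have "infdist w S \<le> infdist x S + e"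
      using infdist_triangle[of w S x] by (simp add: dist_commute)
    then have "ereal (infdist w S) \<le> ereal (infdist x S + e)" by simp
    also have "\<dots> < reach S" using e(2) by simp
    finally show "infdist w S < reach S" .
  qed
  have "continuous_on (cball x e) f"
    unfolding f_def by (intro continuous_intros cont) (use nz in auto)
  moreover have "f \<in> cball x e \<rightarrow> cball x e"
    using e(1) nz by (auto simp: f_def dist_norm)
  ultimately obtain w where w: "w \<in> cball x e" "f w = w"
    using brouwer[of "cball x e" f] e(1) by auto
  define c where "c = closest_point S w"
  have weq: "w - x = (e / norm (x - c)) *\<^sub>R (x - c)"
    using w(2) unfolding f_def c_def by (metis add_diff_cancel_left')
  have c: "c \<in> S" "dist w c = infdist w S"
    using closest_point_in_set[OF cl ne] closest_point_dist_infdist[OF cl ne] by (auto simp: c_def)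
  have "w - c = (1 + e / norm (x - c)) *\<^sub>R (x - c)"
    using weq by (simp add: algebra_simps)
  then have "dist w c = (1 + e / norm (x - c)) * norm (x - c)"
    using e(1) by (simp add: dist_norm)
  then have wc: "dist w c = dist x c + e"
    using nz[of w] e(1) by (simp add: c_def[symmetric] distrib_right dist_norm[of x])
  have wx: "dist w x = e" using weq e(1) nz[of w] by (simp add: dist_norm c_def)
  have "dist x c \<le> dist x y" if "y \<in> S" for y
    using that wc wx c(2) infdist_le[of y S w] dist_triangle[of w y x] by linarith
  then have "dist x c \<le> infdist x S" using ne by (simp add: infdist_notempty cINF_greatest)
  moreover have "infdist x S < reach S"
    using e by (metis ereal_less_eq(3) le_add_same_cancel1 le_less_trans plus_ereal.simps(1))
  ultimately have "p = c" unfolding p_def using closest_point_unique_reach[OF cl _ c(1)] by auto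
  then have "x + (e / norm (x - p)) *\<^sub>R (x - p) = w" using weq by (simp add: algebra_simps)
  moreover have "dist w z \<ge> dist x c + e" using wc c(2) infdist_le[OF z, of w] by linarith
  moreover have "dist x c \<ge> infdist x S" using infdist_le[OF c(1), of x] .
  ultimately show ?thesis by simp
qed

lemma norm_scaleR_diff_power2:
  fixes u v :: "'a::real_inner"
  shows "(norm (c *\<^sub>R u - v))\<^sup>2 = c\<^sup>2 * (norm u)\<^sup>2 - 2 * c * (v \<bullet> u) + (norm v)\<^sup>2"
  unfolding power2_norm_eq_inner
  by (simp add: inner_diff_left inner_diff_right inner_commute power2_eq_square)

text \<open>Continuing the ray from \<open>p\<close> through \<open>x\<close> to distance
  \<open>r\<close> leaves \<open>z\<close> at distance at least \<open>r\<close> from the new point,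
  by \<open>closest_point_extend_ray\<close>. Expanding the square gives the inequality with
  \<open>r\<close> in place of \<tau>; then \<open>r\<close> tends to \<tau> from below.\<close>

lemma closest_point_reach_inner_le:
  fixes S :: "'a::euclidean_space set"
  assumes S: "compact S" and \<tau>: "reach S = ereal \<tau>" and x: "infdist x S < \<tau>" and z: "z \<in> S"
  defines "p \<equiv> closest_point S x"
  shows "2 * \<tau> * ((z - p) \<bullet> (x - p)) \<le> norm (x - p) * (norm (z - p))\<^sup>2"
proof (cases "x \<in> S")
  case True
  then show ?thesis by (simp add: p_def closest_point_self)
next
  case False
  have ne: "S \<noteq> {}" using z by auto
  have cl: "closed S" using S by (rule compact_imp_closed)
  define n where "n = norm (x - p)"
  have p: "p \<in> S" "n = infdist x S"
    using closest_point_in_set[OF cl ne] closest_point_dist_infdist[OF cl ne]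
    by (auto simp: p_def n_def dist_norm)
  have n0: "n > 0" using p(1) False by (auto simp: n_def)
  have key: "2 * r * ((z - p) \<bullet> (x - p)) \<le> n * (norm (z - p))\<^sup>2" if r: "n < r" "r < \<tau>" for r
  proof -
    have "infdist x S + (r - n) \<le> dist (x + ((r - n) / norm (x - p)) *\<^sub>R (x - p)) z"
      unfolding p_def
      by (rule closest_point_extend_ray[OF S False _ _ z]) (use r p \<tau> in auto)
    moreover have "x + ((r - n) / norm (x - p)) *\<^sub>R (x - p) - z = (r / n) *\<^sub>R (x - p) - (z - p)"
    proof -
      have *: "(r - n) / n = r / n - 1" using n0 by (simp add: field_simps)
      show ?thesis unfolding n_def[symmetric] * by (simp add: algebra_simps)
    qed
    ultimately have "r \<le> norm ((r / n) *\<^sub>R (x - p) - (z - p))"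
      using p(2) by (metis add.commute diff_add_cancel dist_norm)
    then have "r\<^sup>2 \<le> (norm ((r / n) *\<^sub>R (x - p) - (z - p)))\<^sup>2"
      using r n0 by (intro power_mono) auto
    also have "\<dots> = (r / n)\<^sup>2 * n\<^sup>2 - 2 * (r / n) * ((z - p) \<bullet> (x - p)) + (norm (z - p))\<^sup>2"
      unfolding n_def by (rule norm_scaleR_diff_power2)
    also have "(r / n)\<^sup>2 * n\<^sup>2 = r\<^sup>2" using n0 by (simp add: power_divide)
    finally show ?thesis using n0 by (simp add: field_simps)
  qed
  have "((\<lambda>r. 2 * r * ((z - p) \<bullet> (x - p))) \<longlongrightarrow> 2 * \<tau> * ((z - p) \<bullet> (x - p))) (at_left \<tau>)"
    by (intro tendsto_intros)
  moreover have "\<forall>\<^sub>F r in at_left \<tau>. 2 * r * ((z - p) \<bullet> (x - p)) \<le> n * (norm (z - p))\<^sup>2"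
    unfolding eventually_at_left[OF x]
    using key p(2) x by blast
  ultimately show ?thesis
    unfolding n_def using tendsto_upperbound trivial_limit_at_left_real by blast
qed

text \<open>Federer's inequality at both feet, added, bounds \<open>\<tau> - r\<close> times the
  squared chord by \<tau> times the inner product of chord and displacement; Cauchy-Schwarz then
  cancels one factor.\<close>

lemma closest_point_reach_lipschitz:
  fixes S :: "'a::euclidean_space set"
  assumes S: "compact S" "S \<noteq> {}" and \<tau>: "reach S = ereal \<tau>" and r: "0 \<le> r" "r < \<tau>"
    and xy: "infdist x S \<le> r" "infdist y S \<le> r"
  shows "(1 - r / \<tau>) * dist (closest_point S x) (closest_point S y) \<le> dist x y"
proof -
  have cl: "closed S" using S by (simp add: compact_imp_closed)
  define p where "p = closest_point S x"
  define q where "q = closest_point S y"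
  have pS: "p \<in> S" "q \<in> S" using closest_point_in_set[OF cl S(2)] by (auto simp: p_def q_def)
  have nr: "norm (x - p) \<le> r" "norm (y - q) \<le> r"
    using closest_point_dist_infdist[OF cl S(2)] xy by (metis p_def q_def dist_norm)+
  have "2 * \<tau> * ((q - p) \<bullet> (x - p)) \<le> r * (norm (q - p))\<^sup>2"
    using closest_point_reach_inner_le[OF S(1) \<tau> _ pS(2), of x] xy r nr(1)
      mult_right_mono[OF nr(1), of "(norm (q - p))\<^sup>2"] by (simp add: p_def)
  moreover have "2 * \<tau> * ((p - q) \<bullet> (y - q)) \<le> r * (norm (q - p))\<^sup>2"
    using closest_point_reach_inner_le[OF S(1) \<tau> _ pS(1), of y] xy r nr(2)
      mult_right_mono[OF nr(2), of "(norm (q - p))\<^sup>2"] by (simp add: q_def norm_minus_commute)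
  ultimately have "\<tau> * ((q - p) \<bullet> (x - p) + (p - q) \<bullet> (y - q)) \<le> r * (norm (q - p))\<^sup>2"
    by (simp add: algebra_simps)
  also have "(q - p) \<bullet> (x - p) + (p - q) \<bullet> (y - q) = (norm (q - p))\<^sup>2 - (q - p) \<bullet> (y - x)"
    unfolding power2_norm_eq_inner by (simp add: algebra_simps inner_diff_left inner_diff_right)
  finally have "(\<tau> - r) * (norm (q - p))\<^sup>2 \<le> \<tau> * ((q - p) \<bullet> (y - x))"
    by (simp add: algebra_simps)
  also have "\<dots> \<le> \<tau> * (norm (q - p) * norm (y - x))"
    using r by (intro mult_left_mono norm_cauchy_schwarz) auto
  finally have *: "norm (q - p) * ((\<tau> - r) * norm (q - p)) \<le> norm (q - p) * (\<tau> * norm (y - x))"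
    by (simp add: power2_eq_square algebra_simps)
  have "(\<tau> - r) * norm (q - p) \<le> \<tau> * norm (y - x)"
  proof (cases "q = p")
    case True then show ?thesis using r by simp
  next
    case False then show ?thesis using * by simp
  qed
  then show ?thesis using r
    by (simp add: p_def[symmetric] q_def[symmetric] dist_norm norm_minus_commute field_simps)
qed

subsection \<open>Curves parametrized by arc length\<close>

locale arclength_curve =
  fixes a b :: real and \<gamma> :: "real \<Rightarrow> 'a::euclidean_space"
  assumes curve: "simple_C2_arclength_curve a b \<gamma>"
begin

abbreviation vel :: "real \<Rightarrow> 'a" where "vel \<equiv> velocity a b \<gamma>"

abbreviation acc :: "real \<Rightarrow> 'a" where "acc \<equiv> velocity a b vel"

abbreviation \<Gamma> :: "'a set" where "\<Gamma> \<equiv> \<gamma> ` {a..b}"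

lemma a_less_b: "a < b" and inj: "inj_on \<gamma> {a..b}"
  using curve by (auto simp: simple_C2_arclength_curve_def)

lemma norm_vel: "t \<in> {a..b} \<Longrightarrow> norm (vel t) = 1"
  using curve by (auto simp: simple_C2_arclength_curve_def)

lemma deriv_curve: "t \<in> {a..b} \<Longrightarrow> (\<gamma> has_vector_derivative vel t) (at t within {a..b})"
  using curve vector_derivative_works[of \<gamma> "at t within {a..b}"]
  by (auto simp: simple_C2_arclength_curve_def velocity_def)

lemma deriv_vel: "t \<in> {a..b} \<Longrightarrow> (vel has_vector_derivative acc t) (at t within {a..b})"
  using curve vector_derivative_works[of vel "at t within {a..b}"]
  by (auto simp: simple_C2_arclength_curve_def velocity_def[of a b vel])

lemma continuous_on_curve: "continuous_on {a..b} \<gamma>"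
  using deriv_curve has_vector_derivative_continuous
  unfolding continuous_on_eq_continuous_within by blast

lemma compact_curve: "compact \<Gamma>" and closed_curve: "closed \<Gamma>" and curve_ne: "\<Gamma> \<noteq> {}"
  using compact_continuous_image[OF continuous_on_curve] a_less_b
  by (auto simp: compact_imp_closed)

lemma deriv_bound:
  fixes f :: "real \<Rightarrow> 'a"
  assumes "\<And>u. u \<in> {a..b} \<Longrightarrow> (f has_vector_derivative f' u) (at u within {a..b})"
    and "\<And>u. u \<in> {a..b} \<Longrightarrow> norm (f' u) \<le> K" and "s \<in> {a..b}" "t \<in> {a..b}"
  shows "norm (f s - f t) \<le> K * \<bar>s - t\<bar>"
proof -
  have "norm (f s - f t) \<le> K * norm (s - t)"
  proof (rule differentiable_bound[of "{a..b}" f "\<lambda>u h. h *\<^sub>R f' u"])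
    show "onorm (\<lambda>h. h *\<^sub>R f' u) \<le> K" if "u \<in> {a..b}" for u
      using assms(2)[OF that] by (intro onorm_le) (simp add: mult.commute[of K] mult_left_mono)
  qed (use assms in \<open>auto simp: has_vector_derivative_def\<close>)
  then show ?thesis by simp
qed

lemma chord_le: "s \<in> {a..b} \<Longrightarrow> t \<in> {a..b} \<Longrightarrow> norm (\<gamma> s - \<gamma> t) \<le> \<bar>s - t\<bar>"
  using deriv_bound[where f = \<gamma> and f' = vel and K = 1, OF deriv_curve] by (simp add: norm_vel)

text \<open>The constant stays a parameter: at first any \<open>K\<close> from compactness serves,
  later \<open>1 / \<tau>\<close>, once the reach has bounded the second derivative.\<close>

definition vel_lipschitz :: "real \<Rightarrow> bool" where
  "vel_lipschitz K \<longleftrightarrow> 0 \<le> K \<and> (\<forall>s\<in>{a..b}. \<forall>t\<in>{a..b}. norm (vel s - vel t) \<le> K * \<bar>s - t\<bar>)"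

lemma vel_lipschitz_acc:
  assumes "\<And>u. u \<in> {a..b} \<Longrightarrow> norm (acc u) \<le> K"
  shows "vel_lipschitz K"
proof -
  have "0 \<le> K" using order_trans[OF norm_ge_zero assms[of a]] a_less_b by simp
  moreover have "norm (vel s - vel t) \<le> K * \<bar>s - t\<bar>" if "s \<in> {a..b}" "t \<in> {a..b}" for s t
    by (rule deriv_bound[where f = vel and f' = acc]) (use deriv_vel assms that in blast)+
  ultimately show ?thesis by (simp add: vel_lipschitz_def)
qed

lemma ex_vel_lipschitz: "\<exists>K. vel_lipschitz K"
proof -
  have "compact (acc ` {a..b})"
    using curve by (intro compact_continuous_image) (auto simp: simple_C2_arclength_curve_def)
  then obtain K where "\<And>u. u \<in> {a..b} \<Longrightarrow> norm (acc u) \<le> K"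
    by (meson compact_imp_bounded bounded_iff imageI)
  then show ?thesis using vel_lipschitz_acc by blast
qed

text \<open>For unit vectors the squared distance is twice one minus the inner product, so the
  Lipschitz bound enters squared.\<close>

lemma inner_vel_bounds:
  assumes K: "vel_lipschitz K" and s: "s \<in> {a..b}" and t: "t \<in> {a..b}"
  shows "0 \<le> 1 - vel t \<bullet> vel s" "1 - vel t \<bullet> vel s \<le> K\<^sup>2 * (s - t)\<^sup>2 / 2"
proof -
  have "(norm (vel s - vel t))\<^sup>2 = 2 * (1 - vel t \<bullet> vel s)"
    using norm_vel[OF s] norm_vel[OF t]
    by (simp add: norm_eq_1 power2_norm_eq_inner inner_diff_left inner_diff_right inner_commute)
  moreover have "(norm (vel s - vel t))\<^sup>2 \<le> (K * \<bar>s - t\<bar>)\<^sup>2"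
    using K s t by (intro power_mono) (auto simp: vel_lipschitz_def)
  ultimately show "0 \<le> 1 - vel t \<bullet> vel s" "1 - vel t \<bullet> vel s \<le> K\<^sup>2 * (s - t)\<^sup>2 / 2"
    using zero_le_power2[of "norm (vel s - vel t)"] by (auto simp: power_mult_distrib)
qed

lemma deriv_nonneg_mono:
  fixes f :: "real \<Rightarrow> real"
  assumes "\<And>u. u \<in> {a..b} \<Longrightarrow> (f has_real_derivative f' u) (at u within {a..b})"
    and "\<And>u. u \<in> {a..b} \<Longrightarrow> 0 \<le> f' u" and "a \<le> s" "s \<le> t" "t \<le> b"
  shows "f s \<le> f t"
proof (rule DERIV_nonneg_imp_increasing_open[of s t f])
  show "\<exists>y. (f has_real_derivative y) (at u) \<and> 0 \<le> y" if "s < u" "u < t" for u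
    using assms(1,2)[of u] assms(3-5) that at_within_Icc_at[of a u b] by auto
  have "continuous_on {a..b} f"
    using assms(1) DERIV_continuous unfolding continuous_on_eq_continuous_within by blast
  then show "continuous_on {s..t} f" by (rule continuous_on_subset) (use assms in auto)
qed (use assms in auto)

text \<open>\<open>D\<close> is the lag of the tangential advance behind arc length. Its derivative
  lies between 0 and \<open>K\<^sup>2 * (u - t)\<^sup>2 / 2\<close>, so \<open>D\<close> and
  \<open>E\<close>, the cubic minus \<open>D\<close>, both increase. They vanish at
  \<open>t\<close>, which settles both signs of \<open>s - t\<close>.\<close>

lemma tangential_advance:
  assumes K: "vel_lipschitz K" and s: "s \<in> {a..b}" and t: "t \<in> {a..b}"
  shows "\<bar>vel t \<bullet> (\<gamma> s - \<gamma> t) - (s - t)\<bar> \<le> K\<^sup>2 * \<bar>s - t\<bar> ^ 3 / 6"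
proof -
  define D where "D u = (u - t) - vel t \<bullet> (\<gamma> u - \<gamma> t)" for u
  define E where "E u = K\<^sup>2 * (u - t) ^ 3 / 6 - D u" for u
  have D': "(D has_real_derivative 1 - vel t \<bullet> vel u) (at u within {a..b})" if "u \<in> {a..b}" for u
  proof -
    have "((\<lambda>u. \<gamma> u - \<gamma> t) has_vector_derivative vel u) (at u within {a..b})"
      using deriv_curve[OF that] by (auto intro!: derivative_eq_intros)
    from bounded_linear.has_vector_derivative[OF bounded_linear_inner_right this, of "vel t"]
    have "((\<lambda>u. vel t \<bullet> (\<gamma> u - \<gamma> t)) has_real_derivative vel t \<bullet> vel u) (at u within {a..b})"
      by (simp add: has_real_derivative_iff_has_vector_derivative)
    then show ?thesis unfolding D_def by (auto intro!: derivative_eq_intros)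
  qed
  have E': "(E has_real_derivative K\<^sup>2 * (u - t)\<^sup>2 / 2 - (1 - vel t \<bullet> vel u)) (at u within {a..b})"
    if "u \<in> {a..b}" for u
    unfolding E_def
    by (rule DERIV_diff[OF _ D'[OF that]]) (auto intro!: derivative_eq_intros simp: power2_eq_square)
  have mono: "D u \<le> D w" "E u \<le> E w" if "a \<le> u" "u \<le> w" "w \<le> b" for u w
    using deriv_nonneg_mono[where f = D, OF D' _ that] deriv_nonneg_mono[where f = E, OF E' _ that] inner_vel_bounds[OF K _ t]
    by auto
  have z: "D t = 0" "E t = 0" by (auto simp: D_def E_def)
  show ?thesis
  proof (cases "t \<le> s")
    case True
    then show ?thesis using mono[of t s] z s t unfolding E_def by (auto simp: D_def)
  next
    case False
    then have "\<bar>s - t\<bar> ^ 3 = - ((s - t) ^ 3)" by (simp add: power3_eq_cube algebra_simps)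
    then show ?thesis using False mono[of s t] z s t unfolding E_def by (auto simp: D_def)
  qed
qed

text \<open>Between \<open>t\<close> and \<open>s\<close> the velocity differs from
  \<open>vel t\<close> by at most \<open>K * \<bar>s - t\<bar>\<close>. The constant is not sharp;
  the quadratic order is what matters.\<close>

lemma first_order_remainder:
  assumes K: "vel_lipschitz K" and s: "s \<in> {a..b}" and t: "t \<in> {a..b}"
  shows "norm (\<gamma> s - \<gamma> t - (s - t) *\<^sub>R vel t) \<le> K * (s - t)\<^sup>2"
proof -
  have sub: "closed_segment t s \<subseteq> {a..b}" using s t by (simp add: closed_segment_subset)
  have "norm (\<gamma> s - \<gamma> t - (s - t) *\<^sub>R vel t) \<le> norm (s - t) * (K * \<bar>s - t\<bar>)"
  proof (rule vector_differentiable_bound_linearization[where S = "closed_segment t s"])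
    fix u assume u: "u \<in> closed_segment t s"
    then have ui: "u \<in> {a..b}" using sub by auto
    show "(\<gamma> has_vector_derivative vel u) (at u within closed_segment t s)"
      using has_vector_derivative_within_subset[OF deriv_curve[OF ui] sub] .
    have "\<bar>u - t\<bar> \<le> \<bar>s - t\<bar>" using u by (auto simp: closed_segment_eq_real_ivl split: if_splits)
    then have "K * \<bar>u - t\<bar> \<le> K * \<bar>s - t\<bar>"
      using K by (intro mult_left_mono) (auto simp: vel_lipschitz_def)
    moreover have "norm (vel u - vel t) \<le> K * \<bar>u - t\<bar>"
      using K ui t unfolding vel_lipschitz_def by blast
    ultimately show "norm (vel u - vel t) \<le> K * \<bar>s - t\<bar>" by linarith
  qed auto
  then show ?thesis by (simp add: power2_eq_square mult_ac)
qed

lemma chord_ge: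
  assumes "vel_lipschitz K" "s \<in> {a..b}" "t \<in> {a..b}"
  shows "\<bar>s - t\<bar> - K\<^sup>2 * \<bar>s - t\<bar> ^ 3 / 6 \<le> norm (\<gamma> s - \<gamma> t)"
proof -
  have "\<bar>vel t \<bullet> (\<gamma> s - \<gamma> t)\<bar> \<le> norm (\<gamma> s - \<gamma> t)"
    using Cauchy_Schwarz_ineq2[of "vel t"] norm_vel[OF assms(3)] by (metis mult_1)
  then show ?thesis using tangential_advance[OF assms] by linarith
qed

lemma param_curve: "t \<in> {a..b} \<Longrightarrow> param a b \<gamma> (\<gamma> t) = t"
  unfolding param_def using inj by (rule the_inv_into_f_f)

lemma curve_param: "z \<in> \<Gamma> \<Longrightarrow> \<gamma> (param a b \<gamma> z) = z" "z \<in> \<Gamma> \<Longrightarrow> param a b \<gamma> z \<in> {a..b}"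
  by (auto simp: param_curve)

text \<open>The inverse of \<gamma> is uniformly continuous by compactness, so a short chord spans a
  short arc and distant stretches of the curve cannot interfere. On a short arc the cubic loss in
  \<open>chord_ge\<close> is at most the fraction \<open>c\<close>.\<close>

lemma chord_arc_local:
  assumes c: "0 < c"
  shows "\<exists>d>0. \<forall>s\<in>{a..b}. \<forall>t\<in>{a..b}. norm (\<gamma> s - \<gamma> t) < d \<longrightarrow> (1 - c) * \<bar>s - t\<bar> \<le> norm (\<gamma> s - \<gamma> t)"
proof -
  obtain K where K: "vel_lipschitz K" using ex_vel_lipschitz ..
  \<comment> \<open>This ensures \<open>K\<^sup>2 * h\<^sup>2 \<le> c\<close>: one factor
    \<open>h\<close> is bounded by 1, the other by the quotient. The \<open>+ 1\<close> covers
    \<open>K = 0\<close>.\<close>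
  define h where "h = min 1 (c / (K\<^sup>2 + 1))"
  have h: "h > 0" using c by (simp add: h_def add_nonneg_pos)
  have "continuous_on \<Gamma> (param a b \<gamma>)"
    by (rule continuous_on_inv[OF continuous_on_curve]) (auto simp: param_curve)
  then have "uniformly_continuous_on \<Gamma> (param a b \<gamma>)"
    using compact_curve compact_uniformly_continuous by blast
  then obtain d where d: "d > 0"
    "\<And>y z. y \<in> \<Gamma> \<Longrightarrow> z \<in> \<Gamma> \<Longrightarrow> dist y z < d \<Longrightarrow> dist (param a b \<gamma> y) (param a b \<gamma> z) < h"
    using h unfolding uniformly_continuous_on_def by (metis dist_commute)
  show ?thesis
  proof (intro exI[of _ d] conjI ballI impI d(1))
    fix s t assume st: "s \<in> {a..b}" "t \<in> {a..b}" "norm (\<gamma> s - \<gamma> t) < d"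
    have lt: "\<bar>s - t\<bar> < h"
      using d(2)[of "\<gamma> s" "\<gamma> t"] st by (simp add: dist_norm param_curve)
    have "K\<^sup>2 * \<bar>s - t\<bar>\<^sup>2 \<le> c"
    proof -
      have "\<bar>s - t\<bar>\<^sup>2 \<le> h * 1"
        unfolding power2_eq_square using lt by (intro mult_mono) (auto simp: h_def)
      then have "K\<^sup>2 * \<bar>s - t\<bar>\<^sup>2 \<le> K\<^sup>2 * (c / (K\<^sup>2 + 1))"
        by (intro mult_left_mono) (auto simp: h_def)
      also have "\<dots> \<le> c"
      using c add_nonneg_pos[of "K\<^sup>2" 1] by (simp add: pos_divide_le_eq algebra_simps)
      finally show ?thesis .
    qed
    then have "K\<^sup>2 * \<bar>s - t\<bar>\<^sup>2 * \<bar>s - t\<bar> \<le> c * \<bar>s - t\<bar>" by (intro mult_right_mono) auto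
    moreover have "K\<^sup>2 * \<bar>s - t\<bar> ^ 3 = K\<^sup>2 * \<bar>s - t\<bar>\<^sup>2 * \<bar>s - t\<bar>"
      by (simp add: power3_eq_cube power2_eq_square)
    moreover have "0 \<le> c * \<bar>s - t\<bar>" using c by simp
    ultimately have "K\<^sup>2 * \<bar>s - t\<bar> ^ 3 / 6 \<le> c * \<bar>s - t\<bar>" by linarith
    then show "(1 - c) * \<bar>s - t\<bar> \<le> norm (\<gamma> s - \<gamma> t)"
      using chord_ge[OF K st(1,2)] by (simp add: algebra_simps)
  qed
qed

section \<open>Projection onto the curve and distance along it\<close>

lemma proj_mem: "proj a b \<gamma> x \<in> \<Gamma>"
  unfolding proj_def using closed_curve curve_ne by (rule closest_point_in_set)

lemma dist_proj: "dist x (proj a b \<gamma> x) = infdist x \<Gamma>"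
  unfolding proj_def using closed_curve curve_ne by (rule closest_point_dist_infdist)

lemma proj_self: "z \<in> \<Gamma> \<Longrightarrow> proj a b \<gamma> z = z"
  by (simp add: proj_def closest_point_self)

lemma norm_proj_diff_le: "norm (proj a b \<gamma> x - proj a b \<gamma> y) \<le> curve_dist a b \<gamma> x y"
  using chord_le[OF curve_param(2) curve_param(2), OF proj_mem proj_mem]
  by (simp add: curve_param(1) proj_mem curve_dist_def)

lemma tangent_eq: "tangent a b \<gamma> x = vel (param a b \<gamma> (proj a b \<gamma> x))"
  by (simp add: tangent_def)

lemma param_proj: "param a b \<gamma> (proj a b \<gamma> x) \<in> {a..b}"
  using curve_param(2) proj_mem .

lemma norm_tangent: "norm (tangent a b \<gamma> x) = 1"
  unfolding tangent_eq using norm_vel param_proj .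

lemma curve_param_proj: "\<gamma> (param a b \<gamma> (proj a b \<gamma> x)) = proj a b \<gamma> x"
  using curve_param(1) proj_mem .

lemma curve_dist_nonneg: "0 \<le> curve_dist a b \<gamma> x y"
  by (simp add: curve_dist_def)

lemma curve_dist_le_length: "curve_dist a b \<gamma> x y \<le> b - a"
  using param_proj[of x] param_proj[of y] by (auto simp: curve_dist_def)

text \<open>At an end of the curve minimality gives only a sign condition on this inner product, so
  orthogonality is carried as a separate condition.\<close>

definition orthogonal_offset :: "'a \<Rightarrow> bool" where
  "orthogonal_offset x \<longleftrightarrow> tangent a b \<gamma> x \<bullet> (x - proj a b \<gamma> x) = 0"

lemma tangent_inner_split:
  assumes "orthogonal_offset y"
  shows "tangent a b \<gamma> y \<bullet> (x - y)
    = tangent a b \<gamma> y \<bullet> (proj a b \<gamma> x - proj a b \<gamma> y) + tangent a b \<gamma> y \<bullet> (x - proj a b \<gamma> x)"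
  using assms by (simp add: orthogonal_offset_def inner_diff_right)

lemma norm_offset_le: "infdist x \<Gamma> \<le> B \<Longrightarrow> norm (x - proj a b \<gamma> x) \<le> B"
  by (simp add: dist_proj[symmetric] dist_norm)

lemma dist_le_curve_dist:
  assumes "infdist x \<Gamma> \<le> B" "infdist y \<Gamma> \<le> B"
  shows "norm (x - y) \<le> 2 * B + curve_dist a b \<gamma> x y"
proof -
  have "norm (x - y) = norm ((x - proj a b \<gamma> x) + (proj a b \<gamma> x - proj a b \<gamma> y) - (y - proj a b \<gamma> y))"
    by simp
  also have "\<dots> \<le> norm (x - proj a b \<gamma> x) + norm (proj a b \<gamma> x - proj a b \<gamma> y) + norm (y - proj a b \<gamma> y)"
    by (meson norm_triangle_ineq norm_triangle_ineq4 add_mono order_refl order_trans)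
  finally show ?thesis using norm_offset_le[OF assms(1)] norm_offset_le[OF assms(2)] norm_proj_diff_le[of x y]
    by linarith
qed

end

section \<open>Curvature bound and projection of segments for a curve of finite reach\<close>

locale reach_curve = arclength_curve +
  fixes \<tau> :: real
  assumes reach: "reach \<Gamma> = ereal \<tau>" and \<tau>_pos: "0 < \<tau>"
begin

text \<open>
  For short normal vectors the bound on the second derivative already shows that the foot
  point is the nearest point; the reach then takes over.
\<close>

lemma normal_inner_le:
  assumes t: "t \<in> {a..b}" and v: "v \<bullet> vel t = 0" and z: "z \<in> \<Gamma>"
  shows "2 * \<tau> * (v \<bullet> (z - \<gamma> t)) \<le> norm v * (norm (z - \<gamma> t))\<^sup>2"
proof (cases "v = 0")
  case False
  obtain K where K: "vel_lipschitz K" using ex_vel_lipschitz ..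
  have K0: "0 \<le> K" using K by (simp add: vel_lipschitz_def)
  obtain d where d: "d > 0" "\<And>s. s \<in> {a..b} \<Longrightarrow> norm (\<gamma> s - \<gamma> t) < d \<Longrightarrow> \<bar>s - t\<bar> \<le> 2 * norm (\<gamma> s - \<gamma> t)"
    using chord_arc_local[of "1/2"] t by force
  define p where "p = \<gamma> t"
  have p: "p \<in> \<Gamma>" using t by (simp add: p_def)
  \<comment> \<open>Three demands: \<open>r\<close> below \<tau> makes the nearest point of
    \<open>y\<close> unique; \<open>2 * r \<le> d\<close> keeps curve points at distance at least
    \<open>d\<close> from \<open>p\<close> away from \<open>y\<close>; and
    \<open>8 * r * K \<le> 1\<close> keeps the nearby arc away, as it bends only
    quadratically.\<close>
  define r where "r = min (\<tau> / 2) (min (d / 2) (1 / (8 * (K + 1))))"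
  have r: "0 < r" "r < \<tau>" "2 * r \<le> d" using \<tau>_pos d(1) K0 by (auto simp: r_def)
  have rK: "8 * r * K \<le> 1"
  proof -
    have "8 * r * K \<le> 8 * (1 / (8 * (K + 1))) * K"
      using K0 by (intro mult_right_mono mult_left_mono) (auto simp: r_def)
    also have "\<dots> \<le> 1" using K0 by (simp add: field_simps)
    finally show ?thesis .
  qed
  define n where "n = v /\<^sub>R norm v"
  have n: "norm n = 1" "n \<bullet> vel t = 0" using False v by (auto simp: n_def)
  define y where "y = p + r *\<^sub>R n"
  have ge: "r \<le> dist y w" if w: "w \<in> \<Gamma>" for w
  proof (cases "norm (w - p) < d")
    case True
    obtain s where s: "s \<in> {a..b}" "w = \<gamma> s" using w by auto
    have "n \<bullet> (w - p) = n \<bullet> (\<gamma> s - \<gamma> t - (s - t) *\<^sub>R vel t)"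
      using n(2) by (simp add: s p_def inner_diff_right)
    also have "\<dots> \<le> K * (s - t)\<^sup>2"
      using norm_cauchy_schwarz[of n] first_order_remainder[OF K s(1) t] n(1)
      by (metis mult_1 order_trans)
    also have "\<dots> \<le> K * (4 * (norm (w - p))\<^sup>2)"
    proof -
      have "\<bar>s - t\<bar>\<^sup>2 \<le> (2 * norm (w - p))\<^sup>2"
        using d(2)[OF s(1)] True by (intro power_mono) (auto simp: s p_def)
      then show ?thesis using K0 by (intro mult_left_mono) (auto simp: power_mult_distrib)
    qed
    finally have "2 * r * (n \<bullet> (w - p)) \<le> 2 * r * (K * (4 * (norm (w - p))\<^sup>2))"
      using r(1) by (intro mult_left_mono) auto
    also have "\<dots> = (8 * r * K) * (norm (w - p))\<^sup>2" by simp
    also have "\<dots> \<le> 1 * (norm (w - p))\<^sup>2" using rK by (intro mult_right_mono) auto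
    finally have "r\<^sup>2 \<le> (norm (r *\<^sub>R n - (w - p)))\<^sup>2"
      unfolding norm_scaleR_diff_power2 n(1) by (simp add: inner_commute)
    then have "r \<le> norm (r *\<^sub>R n - (w - p))" by (rule power2_le_imp_le) simp
    then show ?thesis by (simp add: y_def dist_norm algebra_simps)
  next
    case False
    have "norm (w - p) \<le> dist y w + r"
      using dist_triangle[of w p y] n(1) r(1) by (simp add: y_def dist_norm norm_minus_commute)
    then show ?thesis using False r(3) by linarith
  qed
  have yp: "dist y p = r" using r(1) n(1) by (simp add: y_def dist_norm)
  have inf: "infdist y \<Gamma> = r"
  proof (rule antisym)
    show "r \<le> infdist y \<Gamma>" using ge curve_ne by (simp add: infdist_notempty cINF_greatest)
  qed (use infdist_le[OF p, of y] yp in simp)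
  then have "closest_point \<Gamma> y = p"
    using closest_point_unique_reach[OF closed_curve _ p, of y] reach yp r(2) by simp
  \<comment> \<open>Federer's inequality for the short normal \<open>r *\<^sub>R n\<close> is
    homogeneous in the normal, hence scales up to \<open>v\<close>.\<close>
  then have "2 * \<tau> * ((z - p) \<bullet> (r *\<^sub>R n)) \<le> r * (norm (z - p))\<^sup>2"
    using closest_point_reach_inner_le[OF compact_curve reach _ z, of y] inf r n(1) by (simp add: y_def)
  then have "r * (2 * \<tau> * (n \<bullet> (z - p))) \<le> r * (norm (z - p))\<^sup>2"
    by (simp add: inner_commute mult_ac)
  then have "2 * \<tau> * (n \<bullet> (z - p)) \<le> (norm (z - p))\<^sup>2" using r(1) by simp
  then have "norm v * (2 * \<tau> * (n \<bullet> (z - p))) \<le> norm v * (norm (z - p))\<^sup>2"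
    by (intro mult_left_mono) auto
  then show ?thesis using False by (simp add: n_def p_def field_simps)
qed simp

text \<open>The tangential part of the remainder is cubically small by
  \<open>tangential_advance\<close>. The normal part \<open>w\<close> has its own squared norm as
  inner product with the chord, so \<open>normal_inner_le\<close> applied to \<open>w\<close> itself
  bounds its length.\<close>

lemma remainder_le:
  assumes K: "vel_lipschitz K" and s: "s \<in> {a..b}" and t: "t \<in> {a..b}"
  shows "norm (\<gamma> s - \<gamma> t - (s - t) *\<^sub>R vel t) \<le> (s - t)\<^sup>2 / (2 * \<tau>) + K\<^sup>2 * \<bar>s - t\<bar> ^ 3 / 6"
proof -
  define e where "e = \<gamma> s - \<gamma> t - (s - t) *\<^sub>R vel t"
  define m where "m = vel t \<bullet> e"
  define w where "w = e - m *\<^sub>R vel t"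
  have vv: "vel t \<bullet> vel t = 1" using norm_vel[OF t] by (simp add: norm_eq_1)
  have "w \<bullet> vel t = e \<bullet> vel t - m * (vel t \<bullet> vel t)" by (simp add: w_def inner_diff_left)
  then have wv: "w \<bullet> vel t = 0" by (simp add: vv m_def inner_commute)
  have m: "\<bar>m\<bar> \<le> K\<^sup>2 * \<bar>s - t\<bar> ^ 3 / 6"
    using tangential_advance[OF K s t] vv by (simp add: m_def e_def inner_diff_right)
  have "(norm w)\<^sup>2 = w \<bullet> (\<gamma> s - \<gamma> t)"
    using wv unfolding power2_norm_eq_inner by (subst (2) w_def) (simp add: e_def inner_diff_right)
  then have "2 * \<tau> * (norm w)\<^sup>2 \<le> norm w * (norm (\<gamma> s - \<gamma> t))\<^sup>2"
    using normal_inner_le[OF t wv, of "\<gamma> s"] s by simp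
  also have "\<dots> \<le> norm w * \<bar>s - t\<bar>\<^sup>2"
    using chord_le[OF s t] by (intro mult_left_mono power_mono) auto
  finally have "norm w * (2 * \<tau> * norm w) \<le> norm w * (s - t)\<^sup>2"
    by (simp add: power2_eq_square mult_ac)
  then have "2 * \<tau> * norm w \<le> (s - t)\<^sup>2" by (cases "w = 0") auto
  then have "norm w \<le> (s - t)\<^sup>2 / (2 * \<tau>)" using \<tau>_pos by (simp add: field_simps)
  moreover have "norm e \<le> norm w + \<bar>m\<bar>"
    using norm_triangle_ineq[of w "m *\<^sub>R vel t"] norm_vel[OF t] by (simp add: w_def)
  ultimately show ?thesis using m by (simp add: e_def)
qed

text \<open>The first-order remainders at \<open>t\<close> and at \<open>s\<close> add up to
  \<open>(s - t) *\<^sub>R (vel s - vel t)\<close>. Hence the difference quotients of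
  \<open>vel\<close> exceed \<open>1 / \<tau>\<close> by at most a multiple of
  \<open>\<bar>s - t\<bar>\<close>, which vanishes in the limit.\<close>

lemma norm_acc_le:
  assumes t: "t \<in> {a..b}"
  shows "norm (acc t) \<le> 1 / \<tau>"
proof -
  obtain K where K: "vel_lipschitz K" using ex_vel_lipschitz ..
  have quot: "norm (vel s - vel t) / \<bar>s - t\<bar> \<le> 1 / \<tau> + K\<^sup>2 * \<bar>s - t\<bar> / 3"
    if s: "s \<in> {a..b}" "s \<noteq> t" for s
  proof -
    define h where "h = \<bar>s - t\<bar>"
    have h: "h > 0" using s(2) by (simp add: h_def)
    have "(s - t) *\<^sub>R (vel s - vel t)
      = (\<gamma> s - \<gamma> t - (s - t) *\<^sub>R vel t) + (\<gamma> t - \<gamma> s - (t - s) *\<^sub>R vel s)"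
      by (simp add: algebra_simps)
    then have "norm ((s - t) *\<^sub>R (vel s - vel t))
      \<le> norm (\<gamma> s - \<gamma> t - (s - t) *\<^sub>R vel t) + norm (\<gamma> t - \<gamma> s - (t - s) *\<^sub>R vel s)"
      by (metis norm_triangle_ineq)
    then have "h * norm (vel s - vel t) \<le> h\<^sup>2 / \<tau> + K\<^sup>2 * h ^ 3 / 3"
      using remainder_le[OF K s(1) t] remainder_le[OF K t s(1)]
      by (simp add: h_def abs_minus_commute power2_commute)
    also have "\<dots> = h * (h * (1 / \<tau> + K\<^sup>2 * h / 3))"
      by (simp add: power2_eq_square power3_eq_cube algebra_simps)
    finally have "norm (vel s - vel t) \<le> h * (1 / \<tau> + K\<^sup>2 * h / 3)" using h by simp
    then show ?thesis using h unfolding h_def[symmetric] by (simp add: pos_divide_le_eq mult.commute)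
  qed
  \<comment> \<open>The error quotient in the definition of the derivative of \<open>vel\<close> at
    \<open>t\<close>.\<close>
  define R where "R s = ((vel s - vel t) - (s - t) *\<^sub>R acc t) /\<^sub>R norm (s - t)" for s
  have le: "norm (acc t) \<le> norm (R s) + (1 / \<tau> + K\<^sup>2 * \<bar>s - t\<bar> / 3)" if s: "s \<in> {a..b}" "s \<noteq> t" for s
  proof -
    have "\<bar>s - t\<bar> * norm (acc t) = norm ((s - t) *\<^sub>R acc t)" by simp
    also have "\<dots> \<le> norm ((vel s - vel t) - (s - t) *\<^sub>R acc t) + norm (vel s - vel t)"
      using norm_triangle_ineq4[of "vel s - vel t" "(vel s - vel t) - (s - t) *\<^sub>R acc t"] by simp
    also have "norm ((vel s - vel t) - (s - t) *\<^sub>R acc t) = \<bar>s - t\<bar> * norm (R s)"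
      using s(2) by (simp add: R_def)
    also have "norm (vel s - vel t) = \<bar>s - t\<bar> * (norm (vel s - vel t) / \<bar>s - t\<bar>)"
      using s(2) by simp
    finally have "\<bar>s - t\<bar> * norm (acc t) \<le> \<bar>s - t\<bar> * (norm (R s) + norm (vel s - vel t) / \<bar>s - t\<bar>)"
      by (simp add: distrib_left)
    then have "norm (acc t) \<le> norm (R s) + norm (vel s - vel t) / \<bar>s - t\<bar>"
      using s(2) by simp
    then show ?thesis using quot[OF s] by linarith
  qed
  have "(R \<longlongrightarrow> 0) (at t within {a..b})"
    using deriv_vel[OF t] unfolding has_vector_derivative_def has_derivative_at_within R_def by blast
  then have "((\<lambda>s. norm (R s) + (1 / \<tau> + K\<^sup>2 * \<bar>s - t\<bar> / 3)) \<longlongrightarrow>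
      norm (0 :: 'a) + (1 / \<tau> + K\<^sup>2 * \<bar>t - t\<bar> / 3)) (at t within {a..b})"
    by (intro tendsto_intros) auto
  then have "norm (acc t) \<le> norm (0 :: 'a) + (1 / \<tau> + K\<^sup>2 * \<bar>t - t\<bar> / 3)"
    by (rule tendsto_lowerbound)
      (use le t a_less_b in \<open>auto simp: eventually_at_filter trivial_limit_within islimpt_Icc\<close>)
  then show ?thesis by simp
qed

lemma vel_lipschitz_reach: "vel_lipschitz (1 / \<tau>)"
  using norm_acc_le by (rule vel_lipschitz_acc)

text \<open>\<open>closest_point_reach_lipschitz\<close> controls chords, whereas arcs are wanted.
  On a fine subdivision of the segment the projected chords are so short that
  \<open>chord_arc_local\<close> bounds \<open>c\<close> times each arc by its chord. Summing and
  letting \<open>c\<close> tend to 1 gives the claim.\<close>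

lemma curve_dist_segment_le:
  assumes seg: "\<And>w. w \<in> closed_segment x y \<Longrightarrow> infdist w \<Gamma> \<le> r" and r: "0 \<le> r" "r < \<tau>"
  shows "(1 - r / \<tau>) * curve_dist a b \<gamma> x y \<le> dist x y"
proof -
  define L where "L = 1 - r / \<tau>"
  have L: "L > 0" using r by (simp add: L_def)
  have "c * (L * curve_dist a b \<gamma> x y) \<le> dist x y" if c: "0 < c" "c < 1" for c
  proof -
    obtain d where d: "d > 0"
      "\<And>s t. s \<in> {a..b} \<Longrightarrow> t \<in> {a..b} \<Longrightarrow> norm (\<gamma> s - \<gamma> t) < d \<Longrightarrow> c * \<bar>s - t\<bar> \<le> norm (\<gamma> s - \<gamma> t)"
      using chord_arc_local[of "1 - c"] c by auto
    \<comment> \<open>The pieces get shorter than \<open>L * d\<close>, so their ends project to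
      points less than \<open>d\<close> apart.\<close>
    obtain n where n: "dist x y / (L * d) < real n" using reals_Archimedean2 by blast
    have n0: "n > 0" using n L d(1) by (metis divide_nonneg_pos gr0I mult_pos_pos not_less of_nat_0 zero_le_dist)
    have small: "dist x y / n < L * d"
      using n n0 L d(1) by (simp add: field_simps)
    define w where "w i = x + (real i / n) *\<^sub>R (y - x)" for i :: nat
    have step: "c * (L * curve_dist a b \<gamma> (w i) (w (Suc i))) \<le> dist x y / n" if i: "i < n" for i
    proof -
      have "w j \<in> closed_segment x y" if "j \<le> n" for j
      proof -
        have "w j = (1 - real j / n) *\<^sub>R x + (real j / n) *\<^sub>R y" by (simp add: w_def algebra_simps)
        then show ?thesis unfolding closed_segment_def using that n0 by (auto intro!: exI[of _ "real j / n"])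
      qed
      then have "infdist (w i) \<Gamma> \<le> r" "infdist (w (Suc i)) \<Gamma> \<le> r" using i seg by auto
      then have "L * dist (proj a b \<gamma> (w i)) (proj a b \<gamma> (w (Suc i))) \<le> dist (w i) (w (Suc i))"
        using closest_point_reach_lipschitz[OF compact_curve curve_ne reach r] by (simp add: proj_def L_def)
      also have "\<dots> = dist x y / n"
      proof -
        have "w (Suc i) - w i = (1 / n) *\<^sub>R (y - x)"
          by (simp add: w_def add_divide_distrib scaleR_left_distrib)
        then have "norm (w (Suc i) - w i) = norm (y - x) / n" by simp
        then show ?thesis by (simp add: dist_norm norm_minus_commute)
      qed
      finally have *: "L * norm (proj a b \<gamma> (w i) - proj a b \<gamma> (w (Suc i))) \<le> dist x y / n"
        by (simp add: dist_norm)
      with small L have "norm (proj a b \<gamma> (w i) - proj a b \<gamma> (w (Suc i))) < d"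
        by (smt (verit) mult_less_cancel_left_pos)
      then have "c * curve_dist a b \<gamma> (w i) (w (Suc i)) \<le> norm (proj a b \<gamma> (w i) - proj a b \<gamma> (w (Suc i)))"
        using d(2)[OF curve_param(2) curve_param(2), OF proj_mem proj_mem]
        by (simp add: curve_param(1) proj_mem curve_dist_def)
      then have "L * (c * curve_dist a b \<gamma> (w i) (w (Suc i)))
          \<le> L * norm (proj a b \<gamma> (w i) - proj a b \<gamma> (w (Suc i)))"
        using L by (intro mult_left_mono) auto
      then show ?thesis using * by (simp add: mult_ac)
    qed
    have "c * (L * curve_dist a b \<gamma> (w 0) (w i)) \<le> i * (dist x y / n)" if "i \<le> n" for i
      using that
    proof (induction i)
      case (Suc i)
      have "curve_dist a b \<gamma> (w 0) (w (Suc i)) \<le> curve_dist a b \<gamma> (w 0) (w i) + curve_dist a b \<gamma> (w i) (w (Suc i))"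
        by (simp add: curve_dist_def)
      then have "(c * L) * curve_dist a b \<gamma> (w 0) (w (Suc i))
          \<le> (c * L) * (curve_dist a b \<gamma> (w 0) (w i) + curve_dist a b \<gamma> (w i) (w (Suc i)))"
        using c L by (intro mult_left_mono) auto
      then show ?case using Suc step[of i] by (simp add: algebra_simps add_divide_distrib)
    qed (simp add: curve_dist_def)
    from this[of n] show ?thesis using n0 by (simp add: w_def)
  qed
  then show ?thesis unfolding L_def[symmetric] by (rule field_le_mult_one_interval)
qed

section \<open>Tangential displacement against distance along the curve\<close>

lemma normal_proj_inner_le:
  assumes "v \<bullet> tangent a b \<gamma> x = 0" "z \<in> \<Gamma>"
  shows "2 * \<tau> * (v \<bullet> (z - proj a b \<gamma> x)) \<le> norm v * (norm (z - proj a b \<gamma> x))\<^sup>2"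
  using normal_inner_le[OF param_proj, of v x z] assms by (simp add: tangent_eq curve_param_proj)

text \<open>The offset of \<open>x\<close> is orthogonal to the tangent at \<open>x\<close>, so only
  the turning of the tangent from \<open>x\<close> to \<open>y\<close> contributes, and curvature at
  most \<open>1 / \<tau>\<close> bounds that.\<close>

lemma tangent_inner_offset_le:
  assumes x: "orthogonal_offset x" "infdist x \<Gamma> \<le> B"
  shows "\<bar>tangent a b \<gamma> y \<bullet> (x - proj a b \<gamma> x)\<bar> \<le> B / \<tau> * curve_dist a b \<gamma> x y"
proof -
  have "norm (tangent a b \<gamma> y - tangent a b \<gamma> x) \<le> 1 / \<tau> * curve_dist a b \<gamma> x y"
    using vel_lipschitz_reach param_proj[of x] param_proj[of y]
    unfolding vel_lipschitz_def tangent_eq curve_dist_def by (metis abs_minus_commute)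
  moreover have "norm (x - proj a b \<gamma> x) \<le> B" using x(2) by (simp add: dist_proj[symmetric] dist_norm)
  ultimately have "norm (tangent a b \<gamma> y - tangent a b \<gamma> x) * norm (x - proj a b \<gamma> x)
      \<le> (1 / \<tau> * curve_dist a b \<gamma> x y) * B"
    using \<tau>_pos curve_dist_nonneg by (intro mult_mono) auto
  moreover have "tangent a b \<gamma> y \<bullet> (x - proj a b \<gamma> x)
      = (tangent a b \<gamma> y - tangent a b \<gamma> x) \<bullet> (x - proj a b \<gamma> x)"
    using x(1) by (simp add: orthogonal_offset_def inner_diff_left)
  ultimately show ?thesis
    using Cauchy_Schwarz_ineq2[of "tangent a b \<gamma> y - tangent a b \<gamma> x" "x - proj a b \<gamma> x"]
    by (simp add: mult.commute)
qed

lemma tangent_inner_le: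
  assumes "orthogonal_offset x" "orthogonal_offset y" "infdist x \<Gamma> \<le> B"
  shows "\<bar>tangent a b \<gamma> y \<bullet> (x - y)\<bar> \<le> (1 + B / \<tau>) * curve_dist a b \<gamma> x y"
proof -
  have "\<bar>tangent a b \<gamma> y \<bullet> (proj a b \<gamma> x - proj a b \<gamma> y)\<bar> \<le> curve_dist a b \<gamma> x y"
    using Cauchy_Schwarz_ineq2[of "tangent a b \<gamma> y"] norm_proj_diff_le[of x y]
    by (metis mult_1 norm_tangent order_trans)
  then show ?thesis
    using tangent_inner_split[OF assms(2), of x] tangent_inner_offset_le[OF assms(1,3), of y]
    by (simp add: distrib_right)
qed

text \<open>The cubic term is the loss of the chord in \<open>tangential_advance\<close> with
  \<open>K = 1 / \<tau>\<close>; the share \<open>B / \<tau>\<close> is the offset of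
  \<open>x\<close> seen by the turned tangent.\<close>

lemma tangent_inner_ge:
  assumes "orthogonal_offset x" "orthogonal_offset y" "infdist x \<Gamma> \<le> B"
  shows "(1 - B / \<tau>) * curve_dist a b \<gamma> x y - (curve_dist a b \<gamma> x y) ^ 3 / (6 * \<tau>\<^sup>2)
    \<le> \<bar>tangent a b \<gamma> y \<bullet> (x - y)\<bar>"
proof -
  have "curve_dist a b \<gamma> x y - (curve_dist a b \<gamma> x y) ^ 3 / (6 * \<tau>\<^sup>2)
      \<le> \<bar>tangent a b \<gamma> y \<bullet> (proj a b \<gamma> x - proj a b \<gamma> y)\<bar>"
    using tangential_advance[OF vel_lipschitz_reach param_proj param_proj, of y x]
    unfolding tangent_eq curve_param_proj curve_dist_def power_one_over
    by (simp add: mult.commute[of "\<tau>\<^sup>2"])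
  then show ?thesis
    using tangent_inner_split[OF assms(2), of x] tangent_inner_offset_le[OF assms(1,3), of y]
    by (simp add: left_diff_distrib)
qed

text \<open>The reversed offset is normal too, so \<open>normal_proj_inner_le\<close> applies with
  both signs.\<close>

lemma offset_inner_chord_le:
  assumes "orthogonal_offset x" "infdist x \<Gamma> \<le> B" "z \<in> \<Gamma>"
  shows "2 * \<tau> * \<bar>(x - proj a b \<gamma> x) \<bullet> (z - proj a b \<gamma> x)\<bar> \<le> B * (norm (z - proj a b \<gamma> x))\<^sup>2"
proof -
  have "norm (x - proj a b \<gamma> x) * (norm (z - proj a b \<gamma> x))\<^sup>2 \<le> B * (norm (z - proj a b \<gamma> x))\<^sup>2"
    using norm_offset_le[OF assms(2)] by (intro mult_right_mono) auto
  moreover have "2 * \<tau> * (v \<bullet> (z - proj a b \<gamma> x)) \<le> norm (x - proj a b \<gamma> x) * (norm (z - proj a b \<gamma> x))\<^sup>2"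
    if "v = x - proj a b \<gamma> x \<or> v = - (x - proj a b \<gamma> x)" for v
  proof -
    have "v \<bullet> tangent a b \<gamma> x = 0" "norm v = norm (x - proj a b \<gamma> x)"
      using that assms(1) by (auto simp: orthogonal_offset_def inner_commute[of _ "tangent a b \<gamma> x"]
          inner_diff_right norm_minus_commute)
    then show ?thesis using normal_proj_inner_le[of v x z] assms(3) by simp
  qed
  from this[of "x - proj a b \<gamma> x"] this[of "- (x - proj a b \<gamma> x)"]
  have "2 * \<tau> * \<bar>(x - proj a b \<gamma> x) \<bullet> (z - proj a b \<gamma> x)\<bar>
      \<le> norm (x - proj a b \<gamma> x) * (norm (z - proj a b \<gamma> x))\<^sup>2"
    unfolding abs_real_def inner_minus_left by auto
  ultimately show ?thesis by linarith
qed

text \<open>Offsets and chord are orthogonal up to terms quadratic in the chord, so squared lengths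
  nearly add as in Pythagoras. Squaring \<open>dist_le_curve_dist\<close> would leave a term linear
  in the curve distance.\<close>

lemma dist_power2_le_curve_dist:
  assumes x: "orthogonal_offset x" "infdist x \<Gamma> \<le> B" and y: "orthogonal_offset y" "infdist y \<Gamma> \<le> B"
  shows "(norm (x - y))\<^sup>2 \<le> 4 * B\<^sup>2 + (1 + 2 * B / \<tau>) * (curve_dist a b \<gamma> x y)\<^sup>2"
proof -
  define p where "p = proj a b \<gamma> x"
  define q where "q = proj a b \<gamma> y"
  define m where "m = x - p"
  define n where "n = y - q"
  have B0: "0 \<le> B" using x(2) infdist_nonneg order_trans by blast
  have 1: "2 * \<tau> * \<bar>m \<bullet> (q - p)\<bar> \<le> B * (norm (q - p))\<^sup>2"
    using offset_inner_chord_le[OF x proj_mem] by (simp add: m_def p_def q_def)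
  have 2: "2 * \<tau> * \<bar>n \<bullet> (p - q)\<bar> \<le> B * (norm (q - p))\<^sup>2"
    using offset_inner_chord_le[OF y proj_mem] by (simp add: n_def p_def q_def norm_minus_commute)
  have mn: "(norm (m - n))\<^sup>2 \<le> 4 * B\<^sup>2"
  proof -
    have "norm (m - n) \<le> 2 * B"
      using norm_triangle_ineq4[of m n] norm_offset_le[OF x(2)] norm_offset_le[OF y(2)]
      by (simp add: m_def n_def p_def q_def)
    then have "(norm (m - n))\<^sup>2 \<le> (2 * B)\<^sup>2" by (intro power_mono) auto
    then show ?thesis by (simp add: power_mult_distrib)
  qed
  have "x - y = (m - n) - (q - p)" by (simp add: m_def n_def)
  then have "(norm (x - y))\<^sup>2 = (norm (m - n))\<^sup>2 + (norm (q - p))\<^sup>2 - 2 * (m \<bullet> (q - p)) - 2 * (n \<bullet> (p - q))"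
    using norm_scaleR_diff_power2[of 1 "m - n" "q - p"]
    by (simp add: inner_diff_left inner_diff_right inner_commute)
  then have "\<tau> * (norm (x - y))\<^sup>2
      = \<tau> * (norm (m - n))\<^sup>2 + \<tau> * (norm (q - p))\<^sup>2 - 2 * \<tau> * (m \<bullet> (q - p)) - 2 * \<tau> * (n \<bullet> (p - q))"
    by (simp only: distrib_left right_diff_distrib mult.assoc mult.left_commute)
  also have "\<dots> \<le> \<tau> * (4 * B\<^sup>2) + \<tau> * (norm (q - p))\<^sup>2 + B * (norm (q - p))\<^sup>2 + B * (norm (q - p))\<^sup>2"
  proof -
    have "\<tau> * (norm (m - n))\<^sup>2 \<le> \<tau> * (4 * B\<^sup>2)" using mn \<tau>_pos by simp
    moreover have "- (2 * \<tau> * (m \<bullet> (q - p))) \<le> 2 * \<tau> * \<bar>m \<bullet> (q - p)\<bar>"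
      "- (2 * \<tau> * (n \<bullet> (p - q))) \<le> 2 * \<tau> * \<bar>n \<bullet> (p - q)\<bar>"
      using \<tau>_pos by (simp_all add: abs_real_def mult_le_0_iff)
    ultimately show ?thesis using 1 2 by linarith
  qed
  also have "\<dots> = \<tau> * (4 * B\<^sup>2 + (1 + 2 * B / \<tau>) * (norm (q - p))\<^sup>2)"
    using \<tau>_pos by (simp add: field_simps)
  finally have "(norm (x - y))\<^sup>2 \<le> 4 * B\<^sup>2 + (1 + 2 * B / \<tau>) * (norm (q - p))\<^sup>2"
    using \<tau>_pos by simp
  also have "\<dots> \<le> 4 * B\<^sup>2 + (1 + 2 * B / \<tau>) * (curve_dist a b \<gamma> x y)\<^sup>2"
    using norm_proj_diff_le[of x y] B0 \<tau>_pos
    by (intro add_left_mono mult_left_mono power_mono) (auto simp: p_def q_def norm_minus_commute)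
  finally show ?thesis .
qed

text \<open>Each point of the segment is within \<open>\<eta> / 2\<close> of one of its ends, so the
  segment stays in the tube of radius \<open>B + \<eta> / 2\<close>.\<close>

lemma curve_dist_le_of_close:
  assumes xy: "infdist x \<Gamma> \<le> B" "infdist y \<Gamma> \<le> B" "norm (x - y) \<le> \<eta>" and lt: "B + \<eta> / 2 < \<tau>"
  shows "(1 - (B + \<eta> / 2) / \<tau>) * curve_dist a b \<gamma> x y \<le> \<eta>"
proof -
  have "infdist w \<Gamma> \<le> B + \<eta> / 2" if w: "w \<in> closed_segment x y" for w
  proof -
    have "dist x w + dist w y = dist x y" using w by (simp add: between_mem_segment[symmetric] between)
    moreover have "infdist w \<Gamma> \<le> infdist x \<Gamma> + dist x w" "infdist w \<Gamma> \<le> infdist y \<Gamma> + dist w y"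
      using infdist_triangle[of w \<Gamma> x] infdist_triangle[of w \<Gamma> y] by (simp_all add: dist_commute)
    ultimately show ?thesis using xy by (simp add: dist_norm)
  qed
  moreover have "0 \<le> B + \<eta> / 2"
    using xy infdist_nonneg[of x \<Gamma>] norm_ge_zero[of "x - y"] by linarith
  ultimately show ?thesis
    using curve_dist_segment_le[of x y "B + \<eta> / 2"] lt xy(3) by (simp add: dist_norm)
qed

text \<open>
  Removing from \<open>x\<close> its displacement along the tangent at \<open>y\<close> leaves a point \<open>c\<close> of the normal
  space over \<open>proj y\<close>. If \<open>c\<close> were at distance at least \<open>\<tau>\<close> from \<open>proj y\<close>, it would be far
  from the curve, because the ball of radius \<open>\<tau>\<close> tangent at \<open>proj y\<close> towards \<open>c\<close> contains no point
  of the curve. So \<open>c\<close> projects to \<open>proj y\<close>.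
\<close>

lemma curve_dist_le_of_small_tangent_inner:
  assumes x: "infdist x \<Gamma> \<le> B" and y: "orthogonal_offset y" "infdist y \<Gamma> \<le> B"
    and \<eta>: "norm (x - y) \<le> \<eta>"
  defines "s \<equiv> tangent a b \<gamma> y \<bullet> (x - y)"
  assumes lt: "2 * B + \<eta> + \<bar>s\<bar> < 2 * \<tau>" "B + \<bar>s\<bar> < \<tau>"
  shows "(1 - (B + \<bar>s\<bar>) / \<tau>) * curve_dist a b \<gamma> x y \<le> \<bar>s\<bar>"
proof -
  define p where "p = proj a b \<gamma> y"
  define e where "e = tangent a b \<gamma> y"
  define c where "c = x - s *\<^sub>R e"
  define u where "u = c - p"
  have p: "p \<in> \<Gamma>" using proj_mem by (simp add: p_def)
  have ee: "e \<bullet> e = 1" using norm_tangent[of y] by (simp add: e_def norm_eq_1)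
  have cy: "(c - y) \<bullet> e = 0"
  proof -
    have "(c - y) \<bullet> e = (x - y) \<bullet> e - s * (e \<bullet> e)" by (simp add: c_def inner_diff_left)
    then show ?thesis unfolding ee by (simp add: s_def e_def inner_commute)
  qed
  have ue: "u \<bullet> e = 0"
    using cy y(1) by (simp add: u_def orthogonal_offset_def e_def p_def inner_diff_left inner_diff_right inner_commute)
  have "norm (c - y) \<le> \<eta>"
  proof -
    have "(norm (x - y))\<^sup>2 = (norm (c - y))\<^sup>2 + (norm (s *\<^sub>R e))\<^sup>2"
      using norm_add_Pythagorean[of "c - y" "s *\<^sub>R e"] cy by (simp add: c_def orthogonal_def)
    then have "(norm (c - y))\<^sup>2 \<le> (norm (x - y))\<^sup>2" by simp
    then show ?thesis using \<eta> by (meson norm_ge_zero order_trans power2_le_imp_le)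
  qed
  then have tle: "norm u \<le> B + \<eta>"
    using norm_triangle_ineq[of "c - y" "y - p"] norm_offset_le[OF y(2)] by (simp add: u_def p_def)
  have norm_c: "2 * \<tau> * (u \<bullet> (z - p)) \<le> norm u * (norm (z - p))\<^sup>2" if "z \<in> \<Gamma>" for z
    using normal_proj_inner_le[of u y z] ue that by (simp add: e_def p_def)
  have xc: "dist x c = \<bar>s\<bar>" using norm_tangent[of y] by (simp add: c_def dist_norm e_def)
  have seg: "infdist w \<Gamma> \<le> B + \<bar>s\<bar>" if "w \<in> closed_segment x c" for w
  proof -
    have "dist w x \<le> dist x c"
      using that by (metis dist_commute dist_in_closed_segment)
    then show ?thesis using infdist_triangle[of w \<Gamma> x] x xc by linarith
  qed
  have infc: "infdist c \<Gamma> \<le> B + \<bar>s\<bar>" using seg[of c] by simp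
  have nu: "norm u < \<tau>"
  proof (rule ccontr)
    assume "\<not> norm u < \<tau>"
    then have u: "\<tau> \<le> norm u" "0 < norm u" using \<tau>_pos by linarith+
    \<comment> \<open>The curve avoids the open ball of radius \<tau> about
      \<open>p + (\<tau> / norm u) *\<^sub>R u\<close>, and \<open>c\<close> is at distance
      \<open>norm u - \<tau>\<close> from that centre.\<close>
    have "2 * \<tau> - norm u \<le> dist c z" if z: "z \<in> \<Gamma>" for z
    proof -
      have "2 * (\<tau> / norm u) * (u \<bullet> (z - p)) \<le> (norm (z - p))\<^sup>2"
        using norm_c[OF z] u(2) by (simp add: field_simps)
      then have "\<tau>\<^sup>2 \<le> (norm ((\<tau> / norm u) *\<^sub>R u - (z - p)))\<^sup>2"
        unfolding norm_scaleR_diff_power2 using u(2) by (simp add: power_divide inner_commute)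
      then have "\<tau> \<le> norm ((\<tau> / norm u) *\<^sub>R u - (z - p))" by (rule power2_le_imp_le) simp
      moreover have "norm (u - (\<tau> / norm u) *\<^sub>R u) = norm u - \<tau>"
      proof -
        have "u - (\<tau> / norm u) *\<^sub>R u = (1 - \<tau> / norm u) *\<^sub>R u" by (simp add: scaleR_left_diff_distrib)
        then show ?thesis using u by (simp add: left_diff_distrib)
      qed
      moreover have "norm ((\<tau> / norm u) *\<^sub>R u - (z - p)) \<le> norm (u - (z - p)) + norm (u - (\<tau> / norm u) *\<^sub>R u)"
        using norm_triangle_ineq4[of "u - (z - p)" "u - (\<tau> / norm u) *\<^sub>R u"]
        by (simp add: algebra_simps)
      moreover have "u - (z - p) = c - z" by (simp add: u_def)
      ultimately show ?thesis by (simp add: dist_norm)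
    qed
    then have "2 * \<tau> - norm u \<le> infdist c \<Gamma>" using curve_ne by (simp add: infdist_notempty cINF_greatest)
    then show False using infc tle lt by linarith
  qed
  \<comment> \<open>With \<open>norm u < \<tau>\<close> the ball about \<open>c\<close> through
    \<open>p\<close> sits inside the tangent ball.\<close>
  have "norm u \<le> dist c z" if z: "z \<in> \<Gamma>" for z
  proof -
    have "2 * \<tau> * (u \<bullet> (z - p)) \<le> \<tau> * (norm (z - p))\<^sup>2"
      using norm_c[OF z] nu mult_right_mono[of "norm u" \<tau> "(norm (z - p))\<^sup>2"] by simp
    then have "2 * (u \<bullet> (z - p)) \<le> (norm (z - p))\<^sup>2" using \<tau>_pos by simp
    then have "(norm u)\<^sup>2 \<le> (norm (u - (z - p)))\<^sup>2"
      using norm_scaleR_diff_power2[of 1 u "z - p"] by (simp add: inner_commute)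
    then show ?thesis by (simp add: u_def dist_norm)
  qed
  then have "dist c p \<le> infdist c \<Gamma>" using curve_ne by (simp add: infdist_notempty cINF_greatest u_def dist_norm)
  then have "proj a b \<gamma> c = p"
    unfolding proj_def using closest_point_unique_reach[OF closed_curve _ p] infc lt reach by simp
  then have "curve_dist a b \<gamma> x c = curve_dist a b \<gamma> x y"
    by (simp add: curve_dist_def p_def proj_self[OF proj_mem])
  moreover have "0 \<le> B + \<bar>s\<bar>" using x infdist_nonneg[of x \<Gamma>] by linarith
  ultimately show ?thesis using curve_dist_segment_le[of x c, OF seg] lt(2) xc by simp
qed

end

subsection \<open>Nearest samples\<close>

lemma kth_closest_prefix:
  assumes "kth_closest N f k i" "1 \<le> k" "k \<le> N"
  obtains J where "J \<subseteq> {1..N}" "card J = k" "\<And>j. j \<in> J \<Longrightarrow> f j \<le> f i"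
proof -
  obtain \<sigma> where \<sigma>: "bij_betw \<sigma> {1..N} {1..N}" "mono_on {1..N} (\<lambda>m. f (\<sigma> m))" "i = \<sigma> k"
    using assms(1) by (auto simp: kth_closest_def)
  have sub: "{1..k} \<subseteq> {1..N}" using assms(3) by auto
  show ?thesis
  proof
    show "\<sigma> ` {1..k} \<subseteq> {1..N}" using \<sigma>(1) sub unfolding bij_betw_def by blast
    have "inj_on \<sigma> {1..k}" using \<sigma>(1) sub unfolding bij_betw_def by (metis inj_on_subset)
    then show "card (\<sigma> ` {1..k}) = k" by (simp add: card_image)
    show "f j \<le> f i" if "j \<in> \<sigma> ` {1..k}" for j
      using that \<sigma>(2,3) sub assms(2,3) by (auto simp: mono_on_def)
  qed
qed

text \<open>Pigeonhole: the \<open>k - 1\<close> earlier positions cannot exhaust \<open>J\<close>,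
  so some member of \<open>J\<close> stands at position \<open>k\<close> or later.\<close>

lemma kth_closest_le:
  assumes "kth_closest N f k i" "1 \<le> k" "k \<le> N"
    and J: "J \<subseteq> {1..N}" "k \<le> card J" "\<And>j. j \<in> J \<Longrightarrow> f j \<le> u"
  shows "f i \<le> u"
proof -
  obtain \<sigma> where \<sigma>: "bij_betw \<sigma> {1..N} {1..N}" "mono_on {1..N} (\<lambda>m. f (\<sigma> m))" "i = \<sigma> k"
    using assms(1) by (auto simp: kth_closest_def)
  have "\<not> J \<subseteq> \<sigma> ` {1..<k}"
  proof
    assume "J \<subseteq> \<sigma> ` {1..<k}"
    then have "card J \<le> card (\<sigma> ` {1..<k})" by (intro card_mono) auto
    also have "\<dots> \<le> k - 1" using card_image_le[of "{1..<k}" \<sigma>] by simp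
    finally show False using J(2) assms(2) by linarith
  qed
  then obtain j where j: "j \<in> J" "j \<notin> \<sigma> ` {1..<k}" by auto
  then obtain m where m: "m \<in> {1..N}" "j = \<sigma> m" using J(1) \<sigma>(1) unfolding bij_betw_def by blast
  then have "k \<le> m" using j(2) by (cases "m < k") auto
  then have "f i \<le> f j" using \<sigma>(2,3) m assms(2,3) by (auto simp: mono_on_def)
  then show ?thesis using J(3)[OF j(1)] by (rule order_trans)
qed

text \<open>
  The \<open>k\<close> auxiliary points, all on one side of \<open>s\<close>, have spacing just above \<open>2 * \<delta>\<close>, so that they
  are approximated by different samples.
\<close>

lemma net_card_le:
  fixes t :: "nat \<Rightarrow> real"
  assumes ab: "a < b" and t: "\<And>i. i \<in> {1..N} \<Longrightarrow> t i \<in> {a..b}"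
    and net: "\<And>u. u \<in> {a..b} \<Longrightarrow> \<exists>i\<in>{1..N}. \<bar>u - t i\<bar> \<le> \<delta>"
    and s: "s \<in> {a..b}" and k: "1 \<le> k" "k \<le> N"
  shows "k \<le> card {i \<in> {1..N}. \<bar>s - t i\<bar> \<le> 2 * \<delta> * k}"
proof -
  have \<delta>: "\<delta> > 0"
  proof (rule ccontr)
    assume "\<not> \<delta> > 0"
    \<comment> \<open>With \<delta> at most 0 every \<open>u\<close> equals some \<open>t i\<close>,
      and a finite set would fill the interval.\<close>
    have "{a..b} \<subseteq> t ` {1..N}"
    proof
      fix u assume "u \<in> {a..b}"
      then obtain i where "i \<in> {1..N}" "\<bar>u - t i\<bar> \<le> \<delta>" using net by blast
      then show "u \<in> t ` {1..N}" using \<open>\<not> \<delta> > 0\<close> by (intro image_eqI[of _ _ i]) auto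
    qed
    then show False using infinite_Icc[OF ab] finite_subset by blast
  qed
  show ?thesis
  proof (cases "s + 2 * \<delta> * k \<le> b \<or> a \<le> s - 2 * \<delta> * k")
    case True
    have nonneg: "0 \<le> 2 * \<delta> * k" using \<delta> by simp
    from True obtain \<epsilon> :: real where \<epsilon>: "\<bar>\<epsilon>\<bar> = 1" "a \<le> s + \<epsilon> * (2 * \<delta> * k)" "s + \<epsilon> * (2 * \<delta> * k) \<le> b"
    proof
      assume "s + 2 * \<delta> * k \<le> b" then show thesis
        using s nonneg by (intro that[of 1]) auto
    next
      assume "a \<le> s - 2 * \<delta> * k" then show thesis
        using s nonneg by (intro that[of "-1"]) auto
    qed
    \<comment> \<open>The surplus is small enough for the last point:
      \<open>(k - 1) * h + \<delta> = 2 * \<delta> * k - \<delta> / k\<close>.\<close>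
    define h where "h = 2 * \<delta> + \<delta> / k"
    have h: "h > 2 * \<delta>" using \<delta> k by (simp add: h_def)
    define w where "w m = s + \<epsilon> * (real m * h)" for m :: nat
    have mh: "0 \<le> real m * h" "real m * h + \<delta> \<le> 2 * \<delta> * k" if m: "m < k" for m
    proof -
      show "0 \<le> real m * h" using h \<delta> by simp
      have "real m * h \<le> (real k - 1) * h" using m h \<delta> by (intro mult_right_mono) auto
      also have "\<dots> = 2 * \<delta> * k - \<delta> - \<delta> / k" using k by (simp add: h_def field_simps)
      finally show "real m * h + \<delta> \<le> 2 * \<delta> * k"
        using divide_nonneg_nonneg[of \<delta> "real k"] \<delta> by linarith
    qed
    have "w m \<in> {a..b}" if "m < k" for m
      using mh[OF that] \<epsilon> s \<delta> by (cases "\<epsilon> = 1") (auto simp: w_def abs_if split: if_splits)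
    then have "\<forall>m\<in>{..<k}. \<exists>i. i \<in> {1..N} \<and> \<bar>w m - t i\<bar> \<le> \<delta>" using net by blast
    then obtain g where g: "\<And>m. m < k \<Longrightarrow> g m \<in> {1..N} \<and> \<bar>w m - t (g m)\<bar> \<le> \<delta>"
      using bchoice[of "{..<k}" "\<lambda>m i. i \<in> {1..N} \<and> \<bar>w m - t i\<bar> \<le> \<delta>"] by auto
    have "inj_on g {..<k}"
    proof (rule inj_onI)
      fix m n assume mn: "m \<in> {..<k}" "n \<in> {..<k}" "g m = g n"
      then have "\<bar>w m - w n\<bar> \<le> 2 * \<delta>" using g[of m] g[of n] by auto
      moreover have "\<bar>w m - w n\<bar> = \<bar>real m - real n\<bar> * h"
      proof -
        have "w m - w n = \<epsilon> * ((real m - real n) * h)" by (simp add: w_def algebra_simps)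
        then show ?thesis using \<epsilon>(1) h \<delta> by (simp add: abs_mult)
      qed
      moreover have "1 * h \<le> \<bar>real m - real n\<bar> * h" if "m \<noteq> n"
        using that h \<delta> by (intro mult_right_mono) auto
      ultimately show "m = n" using h by fastforce
    qed
    then have "k = card (g ` {..<k})" by (simp add: card_image)
    also have "\<dots> \<le> card {i \<in> {1..N}. \<bar>s - t i\<bar> \<le> 2 * \<delta> * k}"
    proof (rule card_mono)
      show "g ` {..<k} \<subseteq> {i \<in> {1..N}. \<bar>s - t i\<bar> \<le> 2 * \<delta> * k}"
      proof clarify
        fix m assume m: "m < k"
        have "\<bar>s - w m\<bar> = real m * h" using \<epsilon>(1) h \<delta> by (simp add: w_def abs_mult)
        then show "g m \<in> {1..N} \<and> \<bar>s - t (g m)\<bar> \<le> 2 * \<delta> * k" using g[OF m] mh(2)[OF m] by auto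
      qed
    qed simp
    finally show ?thesis .
  next
    case False
    \<comment> \<open>With no room on either side, the radius reaches past both ends and every
      sample counts.\<close>
    then have "{i \<in> {1..N}. \<bar>s - t i\<bar> \<le> 2 * \<delta> * k} = {1..N}" using t s by (force simp: abs_le_iff)
    then show ?thesis using k by simp
  qed
qed

text \<open>The points violating the bound form an open null set, and such a set misses the
  support.\<close>

lemma supp_distr_infdist_le:
  fixes X :: "'w \<Rightarrow> 'a::metric_space"
  assumes X: "X \<in> borel_measurable M" and AE: "AE w in M. infdist (X w) S \<le> B"
    and x: "x \<in> supp (distr M borel X)"
  shows "infdist x S \<le> B"
proof (rule ccontr)
  assume "\<not> infdist x S \<le> B"
  define U where "U = {y. B < infdist y S}"
  have U: "open U" unfolding U_def by (intro open_Collect_less continuous_intros)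
  have "AE w in M. w \<notin> X -` U \<inter> space M"
    using AE by eventually_elim (simp add: U_def not_less)
  then have "emeasure M (X -` U \<inter> space M) = 0"
    using measurable_sets[OF X, of U] U by (simp add: AE_iff_null_sets null_setsD1)
  then have "emeasure (distr M borel X) U = 0" using X U by (simp add: emeasure_distr)
  moreover have "x \<in> U" using \<open>\<not> infdist x S \<le> B\<close> by (simp add: U_def)
  ultimately show False using x U by (auto simp: supp_def)
qed

text \<open>For the case that a sample at curve distance at most \<open>e\<close> lies beyond radius
  \<eta>. Then \<open>e\<close> is comparable to \<open>\<eta> - 2 * B\<close>, and the quadratic
  bound makes \<open>B\<close> at most \<open>7 / 8 * e\<close>. So \<eta> is of order
  \<open>e\<close>, while \<open>q\<close> is bounded below, which keeps the factor of
  \<open>d\<close> away from 0.\<close>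

lemma far_sample_bound:
  fixes \<tau> q B \<eta> d e :: real
  assumes \<tau>: "0 < \<tau>" and B: "B = (1 / 2 - q) * \<tau>" "0 \<le> B" and q: "0 < q" and \<eta>: "2 * B < \<eta>"
    and e: "\<eta> \<le> 2 * B + e" "\<eta>\<^sup>2 \<le> 4 * B\<^sup>2 + (1 + 2 * B / \<tau>) * e\<^sup>2" "e < 2 * (\<eta> - 2 * B)" "e < q * \<tau>"
    and d: "0 \<le> d" "(1 - (B + \<eta> / 2) / \<tau>) * d \<le> \<eta>"
  shows "d \<le> 8 * e"
proof -
  define \<epsilon> where "\<epsilon> = \<eta> - 2 * B"
  have \<epsilon>: "0 < \<epsilon>" "\<epsilon> \<le> e" "e < 2 * \<epsilon>" "\<eta> = \<epsilon> + 2 * B" using \<eta> e by (auto simp: \<epsilon>_def)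
  have e0: "e > 0" using \<epsilon> by simp
  have "(1 + 2 * B / \<tau>) * e\<^sup>2 \<le> 2 * e\<^sup>2"
    using B q \<tau> by (intro mult_right_mono) auto
  then have 1: "\<epsilon> * (\<epsilon> + 4 * B) \<le> 2 * e\<^sup>2"
    using e(2) unfolding \<epsilon>(4) by (simp add: power2_eq_square algebra_simps)
  have "(e / 2) * (e / 2 + 4 * B) \<le> \<epsilon> * (\<epsilon> + 4 * B)"
    using \<epsilon> e0 B(2) by (intro mult_mono) auto
  then have "e * (e / 4 + 2 * B) \<le> e * (2 * e)"
    using 1 by (simp add: power2_eq_square algebra_simps)
  then have B2: "B \<le> 7 / 8 * e" using e0 by simp
  \<comment> \<open>Combined with \<open>e < q * \<tau>\<close> this gives
    \<open>q > 4 / 15\<close>, and \<open>3 / 2 * q\<close> then exceeds the \<open>2 / 5\<close>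
    below.\<close>
  then have "(1 / 2 - q) * \<tau> < 7 / 8 * (q * \<tau>)" using B e by linarith
  then have "(1 / 2 - q) * \<tau> < (7 / 8 * q) * \<tau>" by simp
  then have q2: "4 / 15 < q" using \<tau> mult_less_cancel_right_pos[of \<tau> "1 / 2 - q" "7 / 8 * q"] by simp
  have "B + \<eta> / 2 \<le> 2 * B + q * \<tau> / 2" using \<epsilon> e(4) by simp
  also have "\<dots> = (1 - 3 / 2 * q) * \<tau>" using B by (simp add: algebra_simps)
  finally have "(B + \<eta> / 2) / \<tau> \<le> 1 - 3 / 2 * q" using \<tau> by (simp add: pos_divide_le_eq)
  then have "2 / 5 \<le> 1 - (B + \<eta> / 2) / \<tau>" using q2 by linarith
  then have "2 / 5 * d \<le> \<eta>" using d mult_right_mono[of "2 / 5" "1 - (B + \<eta> / 2) / \<tau>" d] by linarith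
  \<comment> \<open>Here \<open>\<eta> \<le> e + 7 / 4 * e\<close>, so
    \<open>d \<le> 55 / 8 * e\<close>.\<close>
  then show ?thesis using B2 \<epsilon> by linarith
qed

text \<open>A bootstrap in units of \<tau>: \<open>up\<close> gives \<open>\<theta> \<le> 1\<close>,
  so the cubic loss is at most \<open>\<theta> / 6\<close>; the resulting linear bound gives
  \<open>\<theta>\<^sup>2 \<le> 6 * q\<close>; now the cubic loss is at most
  \<open>q * \<theta>\<close>, which leaves \<open>\<theta> / 2 \<le> \<rho>\<close>.\<close>

lemma near_sample_bound:
  fixes \<tau> q B d \<sigma> :: real
  assumes \<tau>: "0 < \<tau>" and B: "B = (1 / 2 - q) * \<tau>" and q: "0 < q" "q \<le> 1 / 2"
    and \<sigma>: "\<sigma> < (3 / 2 - q) * q * \<tau>" and d: "0 \<le> d"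
    and up: "(1 - (B + \<sigma>) / \<tau>) * d \<le> \<sigma>"
    and lo: "(1 - B / \<tau>) * d - d ^ 3 / (6 * \<tau>\<^sup>2) \<le> \<sigma>"
  shows "d \<le> 2 * \<sigma>"
proof -
  define \<theta> where "\<theta> = d / \<tau>"
  define \<rho> where "\<rho> = \<sigma> / \<tau>"
  have d_eq: "d = \<theta> * \<tau>" and \<sigma>_eq: "\<sigma> = \<rho> * \<tau>" using \<tau> by (auto simp: \<theta>_def \<rho>_def)
  have B_eq: "B / \<tau> = 1 / 2 - q" using B \<tau> by simp
  have \<theta>0: "0 \<le> \<theta>" using d \<tau> by (simp add: \<theta>_def)
  have \<rho>: "\<rho> < (3 / 2 - q) * q" using \<sigma> \<tau> by (simp add: \<rho>_def pos_divide_less_eq)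
  have up': "(1 / 2 + q - \<rho>) * \<theta> \<le> \<rho>"
  proof -
    have "(1 - (B + \<sigma>) / \<tau>) = 1 / 2 + q - \<rho>" using B_eq by (simp add: add_divide_distrib \<rho>_def)
    then have "((1 / 2 + q - \<rho>) * \<theta>) * \<tau> \<le> \<rho> * \<tau>" using up d_eq \<sigma>_eq by (simp add: mult.assoc)
    then show ?thesis using \<tau> by simp
  qed
  have lo': "(1 / 2 + q) * \<theta> - \<theta> ^ 3 / 6 \<le> \<rho>"
  proof -
    have "d ^ 3 / (6 * \<tau>\<^sup>2) = \<theta> ^ 3 / 6 * \<tau>"
      using \<tau> by (simp add: d_eq power_mult_distrib power3_eq_cube power2_eq_square)
    moreover have "1 - B / \<tau> = 1 / 2 + q" using B_eq by simp
    ultimately have "((1 / 2 + q) * \<theta> - \<theta> ^ 3 / 6) * \<tau> \<le> \<rho> * \<tau>"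
      using lo d_eq \<sigma>_eq by (simp add: left_diff_distrib mult.assoc)
    then show ?thesis using \<tau> by simp
  qed
  \<comment> \<open>Since \<open>1 / 2 + q - 2 * (3 / 2 - q) * q = 2 * (q - 1 / 2)\<^sup>2\<close>,
    \<open>\<rho>\<close> is less than half of \<open>1 / 2 + q\<close>, which contradicts
    \<open>up'\<close> if \<open>\<theta> > 1\<close>.\<close>
  have sq: "0 \<le> (q - 1 / 2)\<^sup>2" by simp
  have "\<theta> \<le> 1"
  proof (rule ccontr)
    assume "\<not> \<theta> \<le> 1"
    have "0 < 1 / 2 + q - \<rho>"
    proof -
      have "0 \<le> q\<^sup>2" by simp
      then show ?thesis using \<rho> q unfolding power2_eq_square left_diff_distrib by linarith
    qed
    then have "(1 / 2 + q - \<rho>) * 1 < (1 / 2 + q - \<rho>) * \<theta>"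
      using \<open>\<not> \<theta> \<le> 1\<close> by (intro mult_strict_left_mono) auto
    then show False using up' \<rho> sq by (simp add: power2_eq_square algebra_simps)
  qed
  then have "\<theta> * \<theta>\<^sup>2 \<le> \<theta> * 1" using \<theta>0 by (intro mult_left_mono) (auto simp: power_le_one)
  then have "\<theta> ^ 3 \<le> \<theta>" by (simp add: power3_eq_cube power2_eq_square)
  then have "(1 / 3 + q) * \<theta> \<le> \<rho>" using lo' by (simp add: algebra_simps)
  also have "\<dots> \<le> 3 / 2 * q"
    using \<rho> zero_le_power2[of q] unfolding power2_eq_square left_diff_distrib by linarith
  finally have "((1 / 3 + q) * \<theta>)\<^sup>2 \<le> (3 / 2 * q)\<^sup>2"
    using \<theta>0 q by (intro power_mono) auto
  then have le: "(1 / 3 + q)\<^sup>2 * \<theta>\<^sup>2 \<le> 9 / 4 * q\<^sup>2" by (simp add: power_mult_distrib power_divide)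
  have "9 / 4 * q\<^sup>2 \<le> (1 / 3 + q)\<^sup>2 * (6 * q)"
  proof -
    have "(1 / 3 + q)\<^sup>2 * (6 * q) - 9 / 4 * q\<^sup>2 = 2 / 3 * q + 7 / 4 * q\<^sup>2 + 6 * q ^ 3"
      by (simp add: power2_eq_square power3_eq_cube algebra_simps)
    also have "\<dots> \<ge> 0" using q by simp
    finally show ?thesis by simp
  qed
  then have "(1 / 3 + q)\<^sup>2 * \<theta>\<^sup>2 \<le> (1 / 3 + q)\<^sup>2 * (6 * q)" using le by linarith
  moreover have "0 < (1 / 3 + q)\<^sup>2" using q by simp
  ultimately have "\<theta>\<^sup>2 \<le> 6 * q" by simp
  then have "\<theta> * \<theta>\<^sup>2 \<le> \<theta> * (6 * q)" using \<theta>0 by (rule mult_left_mono)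
  then have "\<theta> ^ 3 / 6 \<le> q * \<theta>" by (simp add: power3_eq_cube power2_eq_square mult_ac)
  then have "\<theta> \<le> 2 * \<rho>" using lo' by (simp add: algebra_simps)
  then show ?thesis using \<tau> by (simp add: d_eq \<sigma>_eq)
qed

subsection \<open>The proxy metric\<close>

theorem proposition9:
  fixes M :: "'w measure" and X :: "'w \<Rightarrow> real ^ 'd"
    and a b :: real and \<gamma> :: "real \<Rightarrow> real ^ 'd"
    and \<tau> B q \<eta> \<delta> :: real and N k i_proxy i_curve :: nat
    and xbar :: "nat \<Rightarrow> real ^ 'd" and ahat :: "real ^ 'd \<Rightarrow> real ^ 'd"
    and x :: "real ^ 'd"
  defines "\<rho> \<equiv> distr M borel X"
    and "err \<equiv> (MAX i\<in>{1..N}. norm (ahat (xbar i) - tangent a b \<gamma> (xbar i)))"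
    and "len \<equiv> b - a"
  assumes curve: "simple_C2_arclength_curve a b \<gamma>"
    and prob: "prob_space M" and rv: "X \<in> borel_measurable M"
    and orth: "\<forall>y\<in>supp \<rho>. tangent a b \<gamma> y \<bullet> (y - proj a b \<gamma> y) = 0"
    and reach: "reach (\<gamma> ` {a..b}) = ereal \<tau>"
    and bound: "AE w in M. norm (X w - proj a b \<gamma> (X w)) \<le> B"
    and B: "B < \<tau>" "B = (1 / 2 - q) * \<tau>" "q > 0"
    and \<eta>: "2 * B < \<eta>" "\<eta> < \<tau>"
    and k: "1 \<le> k" "k \<le> N"
    and xbar: "\<forall>i\<in>{1..N}. xbar i \<in> supp \<rho>"
    and ahat: "\<forall>i\<in>{1..N}. ahat (xbar i) \<in> sphere 0 1"
    and x: "x \<in> supp \<rho>"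
    and i_proxy: "kth_closest N (\<lambda>i. proxy_dist \<eta> ahat x (xbar i)) k i_proxy"
    and i_curve: "kth_closest N (\<lambda>i. ereal (curve_dist a b \<gamma> x (xbar i))) k i_curve"
    and net: "is_net a b \<gamma> \<delta> ((\<lambda>i. proj a b \<gamma> (xbar i)) ` {1..N})"
    and small: "\<delta> * real k < min (\<eta> - 2 * B) (1 / 2 * (q * \<tau> - (\<tau> + len + 2 * B) * err))"
  shows "curve_dist a b \<gamma> x (xbar i_proxy)
    \<le> 4 * max 2 (max (len + 2 * B) \<tau>) * (curve_dist a b \<gamma> x (xbar i_curve) + err)"
proof -
  interpret arclength_curve a b \<gamma> using curve by unfold_locales
  have "AE w in M. infdist (X w) \<Gamma> \<le> B" using bound by (simp add: dist_proj[symmetric] dist_norm)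
  then have tube: "infdist y \<Gamma> \<le> B" if "y \<in> supp \<rho>" for y
    using supp_distr_infdist_le[OF rv] that unfolding \<rho>_def by blast
  have B0: "0 \<le> B" using tube[OF x] infdist_nonneg order_trans by blast
  have \<tau>0: "0 < \<tau>" using B0 B(1) by linarith
  interpret reach_curve a b \<gamma> \<tau> using reach \<tau>0 by unfold_locales
  have q: "q \<le> 1 / 2" using B0 B(2) \<tau>0 by (simp add: zero_le_mult_iff)
  have B\<tau>: "B / \<tau> = 1 / 2 - q" using B(2) \<tau>0 by simp
  have orthogonal: "orthogonal_offset y" if "y \<in> supp \<rho>" for y
    using orth that by (simp add: orthogonal_offset_def)
  define dc where "dc i = curve_dist a b \<gamma> x (xbar i)" for i
  define e where "e = dc i_curve"
  define L where "L = len + 2 * B"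
  have dc0: "0 \<le> dc i" for i by (simp add: dc_def curve_dist_nonneg)
  have err: "norm (ahat (xbar i) - tangent a b \<gamma> (xbar i)) \<le> err" if "i \<in> {1..N}" for i
    unfolding err_def using that by (intro Max_ge) auto
  have err0: "0 \<le> err" using order_trans[OF norm_ge_zero err[of 1]] k by simp
  have L0: "0 \<le> L" using a_less_b B0 by (simp add: L_def len_def)

  have e_le: "e \<le> 2 * \<delta> * k"
  proof -
    define J where "J = {i \<in> {1..N}. dc i \<le> 2 * \<delta> * k}"
    have "k \<le> card J"
      unfolding J_def dc_def curve_dist_def
    proof (rule net_card_le[OF a_less_b param_proj _ param_proj k])
      fix u assume u: "u \<in> {a..b}"
      then obtain i where i: "i \<in> {1..N}" "curve_dist a b \<gamma> (\<gamma> u) (proj a b \<gamma> (xbar i)) \<le> \<delta>"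
        using net unfolding is_net_def by blast
      moreover have "\<gamma> u \<in> \<Gamma>" using u by simp
      ultimately show "\<exists>i\<in>{1..N}. \<bar>u - param a b \<gamma> (proj a b \<gamma> (xbar i))\<bar> \<le> \<delta>"
        using u by (auto simp: curve_dist_def proj_self proj_mem param_curve)
    qed
    then have "ereal (curve_dist a b \<gamma> x (xbar i_curve)) \<le> ereal (2 * \<delta> * k)"
      by (intro kth_closest_le[OF i_curve k, of J]) (auto simp: J_def dc_def)
    then show ?thesis by (simp add: e_def dc_def)
  qed
  \<comment> \<open>The doubled radius \<open>2 * \<delta> * k\<close> cancels the factor
    \<open>1 / 2\<close> in \<open>small\<close> and doubles the gap
    \<open>\<eta> - 2 * B\<close>.\<close>
  have small1: "e < 2 * (\<eta> - 2 * B)" and small2: "e < q * \<tau> - (\<tau> + L) * err"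
    using e_le small by (simp_all add: L_def algebra_simps)
  have e_q: "e < q * \<tau>"
    using small2 mult_nonneg_nonneg[of "\<tau> + L" err] \<tau>0 L0 err0 by linarith

  obtain J where J: "J \<subseteq> {1..N}" "card J = k" "\<And>j. j \<in> J \<Longrightarrow> dc j \<le> e"
    using kth_closest_prefix[OF i_curve k] by (auto simp: e_def dc_def)
  define i where "i = i_proxy"
  have "i \<in> {1..N}" using i_proxy k by (auto simp: i_def kth_closest_def bij_betw_def)
  \<comment> \<open>\<open>kth_closest\<close> demands a finite distance, which places the selected
    sample within the radius.\<close>
  have in_range: "norm (x - xbar i) \<le> \<eta>"
    using i_proxy by (auto simp: i_def kth_closest_def proxy_dist_def split: if_splits)
  have supp_i: "xbar j \<in> supp \<rho>" if "j \<in> {1..N}" for j using xbar that by blast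

  show ?thesis
  proof (cases "\<forall>j\<in>J. norm (x - xbar j) \<le> \<eta>")
    case False
    \<comment> \<open>The ambient distance of this sample, bounded linearly and quadratically by its
      curve distance, yields the lower bounds \<open>far1\<close> and \<open>far2\<close> on
      \<open>e\<close>.\<close>
    then obtain j where j: "j \<in> J" "\<eta> < norm (x - xbar j)" by auto
    then have xj: "xbar j \<in> supp \<rho>" using supp_i J(1) by auto
    have \<eta>0: "0 \<le> \<eta>" using \<eta> B0 by linarith
    have "norm (x - xbar j) \<le> 2 * B + dc j"
      unfolding dc_def using dist_le_curve_dist[OF tube tube] x xj by blast
    then have far1: "\<eta> \<le> 2 * B + e" using j J(3)[of j] by linarith
    have "\<eta>\<^sup>2 \<le> (norm (x - xbar j))\<^sup>2" using j \<eta>0 by (intro power_mono) auto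
    also have "\<dots> \<le> 4 * B\<^sup>2 + (1 + 2 * B / \<tau>) * (dc j)\<^sup>2"
      unfolding dc_def using dist_power2_le_curve_dist[OF orthogonal tube orthogonal tube] x xj by blast
    also have "\<dots> \<le> 4 * B\<^sup>2 + (1 + 2 * B / \<tau>) * e\<^sup>2"
      using J(3)[OF j(1)] dc0 B0 \<tau>0 by (intro add_left_mono mult_left_mono power_mono) auto
    finally have far2: "\<eta>\<^sup>2 \<le> 4 * B\<^sup>2 + (1 + 2 * B / \<tau>) * e\<^sup>2" .
    have "B < \<tau> / 2" using B(2) mult_pos_pos[OF B(3) \<tau>0] by (simp add: left_diff_distrib)
    then have "(1 - (B + \<eta> / 2) / \<tau>) * dc i \<le> \<eta>"
      unfolding dc_def
      using curve_dist_le_of_close[OF tube tube in_range] x supp_i \<open>i \<in> {1..N}\<close> \<eta> by simp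
    then have "dc i \<le> 8 * e"
      using far_sample_bound[OF \<tau>0 B(2) B0 B(3) \<eta>(1) far1 far2 small1 e_q dc0] by blast
    \<comment> \<open>The entry 2 of the maximum absorbs the constant 8.\<close>
    also have "\<dots> = 4 * 2 * e" by simp
    also have "\<dots> \<le> 4 * max 2 (max (len + 2 * B) \<tau>) * (e + err)"
      using dc0[of i_curve] err0 by (intro mult_mono) (auto simp: e_def)
    finally show ?thesis by (simp add: dc_def e_def i_def)
  next
    case True
    \<comment> \<open>Samples in range are at distance below \<tau> through \<eta>, and at most
      \<open>L\<close> through the curve length and two offsets. The minimum satisfies
      \<open>2 * m \<le> \<tau> + L\<close>, the weight of \<open>err\<close> in
      \<open>small2\<close>.\<close>
    define m where "m = min \<tau> L"
    have m0: "0 \<le> m" using \<tau>0 L0 by (simp add: m_def)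
    have perturb: "\<bar>\<bar>ahat (xbar j) \<bullet> (x - xbar j)\<bar> - \<bar>tangent a b \<gamma> (xbar j) \<bullet> (x - xbar j)\<bar>\<bar> \<le> err * m"
      if j: "j \<in> {1..N}" "norm (x - xbar j) \<le> \<eta>" for j
    proof -
      have "norm (x - xbar j) \<le> 2 * B + dc j"
        unfolding dc_def using dist_le_curve_dist[OF tube tube] x supp_i[OF j(1)] by blast
      then have "norm (x - xbar j) \<le> m"
        using curve_dist_le_length[of x "xbar j"] j(2) \<eta>(2) by (simp add: m_def L_def len_def dc_def)
      then have "norm (ahat (xbar j) - tangent a b \<gamma> (xbar j)) * norm (x - xbar j) \<le> err * m"
        using err[OF j(1)] err0 by (intro mult_mono) auto
      moreover have "\<bar>\<bar>ahat (xbar j) \<bullet> (x - xbar j)\<bar> - \<bar>tangent a b \<gamma> (xbar j) \<bullet> (x - xbar j)\<bar>\<bar>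
          \<le> \<bar>(ahat (xbar j) - tangent a b \<gamma> (xbar j)) \<bullet> (x - xbar j)\<bar>"
        by (simp add: inner_diff_left abs_triangle_ineq3)
      ultimately show ?thesis
        using Cauchy_Schwarz_ineq2[of "ahat (xbar j) - tangent a b \<gamma> (xbar j)" "x - xbar j"] by linarith
    qed
    \<comment> \<open>All \<open>k\<close> samples in \<open>J\<close> obey this bound, hence so
      does the one ranked \<open>k\<close>-th by proxy. The factor \<open>3 / 2 - q\<close> is
      \<open>1 + B / \<tau>\<close>.\<close>
    have "proxy_dist \<eta> ahat x (xbar i_proxy) \<le> ereal ((3 / 2 - q) * e + err * m)"
    proof (rule kth_closest_le[OF i_proxy k J(1)])
      fix j assume j: "j \<in> J"
      then have jN: "j \<in> {1..N}" and jr: "norm (x - xbar j) \<le> \<eta>" using J(1) True by auto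
      have "\<bar>tangent a b \<gamma> (xbar j) \<bullet> (x - xbar j)\<bar> \<le> (1 + B / \<tau>) * dc j"
        unfolding dc_def using tangent_inner_le[OF orthogonal orthogonal tube] x supp_i[OF jN] by blast
      also have "\<dots> \<le> (3 / 2 - q) * e"
        using J(3)[OF j] q B\<tau> by (intro mult_mono) (auto simp: dc0)
      finally show "proxy_dist \<eta> ahat x (xbar j) \<le> ereal ((3 / 2 - q) * e + err * m)"
        using perturb[OF jN jr] jr by (simp add: proxy_dist_def)
    qed (simp add: J(2))
    then have "\<bar>ahat (xbar i) \<bullet> (x - xbar i)\<bar> \<le> (3 / 2 - q) * e + err * m"
      using in_range by (simp add: proxy_dist_def i_def)
    define s where "s = tangent a b \<gamma> (xbar i) \<bullet> (x - xbar i)"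
    \<comment> \<open>The tangent error is paid twice: on the samples in \<open>J\<close>, and in
      passing from \<open>ahat\<close> to the true tangent at the selected sample.\<close>
    have s: "\<bar>s\<bar> \<le> (3 / 2 - q) * e + 2 * err * m"
      using perturb[OF \<open>i \<in> {1..N}\<close> in_range] \<open>\<bar>ahat (xbar i) \<bullet> (x - xbar i)\<bar> \<le> _\<close>
      by (simp add: s_def)
    \<comment> \<open>Because \<open>3 / 2 - q \<ge> 1\<close>, the margin \<open>W\<close> taken
      from \<open>small2\<close> still covers \<open>2 * m * err\<close> after scaling.\<close>
    have s_lt: "\<bar>s\<bar> < (3 / 2 - q) * q * \<tau>"
    proof -
      define W where "W = (\<tau> + L) * err"
      have W0: "0 \<le> W" using \<tau>0 L0 err0 by (simp add: W_def)
      have "(3 / 2 - q) * e < (3 / 2 - q) * (q * \<tau> - W)"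
        using small2 q unfolding W_def by (intro mult_strict_left_mono) auto
      also have "\<dots> = (3 / 2 - q) * q * \<tau> - (3 / 2 - q) * W" by (simp add: right_diff_distrib)
      finally have "(3 / 2 - q) * e < (3 / 2 - q) * q * \<tau> - (3 / 2 - q) * W" .
      moreover have "1 * W \<le> (3 / 2 - q) * W" using q W0 by (intro mult_right_mono) auto
      moreover have "2 * m * err \<le> W"
        unfolding W_def using err0 by (intro mult_right_mono) (auto simp: m_def)
      moreover have "2 * err * m = 2 * m * err" by simp
      ultimately show ?thesis using s by linarith
    qed
    \<comment> \<open>Doubling \<open>B = \<tau> / 2 - q * \<tau>\<close> frees
      \<open>2 * q * \<tau>\<close>, more than the bound \<open>3 / 2 * q * \<tau>\<close> on
      \<open>\<bar>s\<bar>\<close>; the second inequality uses \<open>q \<le> 1 / 2\<close>.\<close>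
    have s_small: "2 * B + \<eta> + \<bar>s\<bar> < 2 * \<tau>" "B + \<bar>s\<bar> < \<tau>"
    proof -
      have "(3 / 2 - q) * q * \<tau> \<le> 3 / 2 * q * \<tau>" using B(3) \<tau>0 by (intro mult_right_mono) auto
      then have "\<bar>s\<bar> < 3 / 2 * (q * \<tau>)" using s_lt by simp
      moreover have "B = \<tau> / 2 - q * \<tau>" using B(2) by (simp add: algebra_simps)
      moreover have "0 < q * \<tau>" "q * \<tau> \<le> 1 / 2 * \<tau>"
        using B(3) \<tau>0 q by (auto intro: mult_right_mono simp del: mult_le_cancel_right)
      ultimately show "2 * B + \<eta> + \<bar>s\<bar> < 2 * \<tau>" "B + \<bar>s\<bar> < \<tau>" using \<eta>(2) by linarith+
    qed
    have "dc i \<le> 2 * \<bar>s\<bar>"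
    proof (rule near_sample_bound[OF \<tau>0 B(2) B(3) q s_lt dc0])
      have xi: "xbar i \<in> supp \<rho>" using supp_i \<open>i \<in> {1..N}\<close> by blast
      show "(1 - (B + \<bar>s\<bar>) / \<tau>) * dc i \<le> \<bar>s\<bar>"
        unfolding dc_def s_def
        by (rule curve_dist_le_of_small_tangent_inner[OF tube[OF x] orthogonal[OF xi] tube[OF xi] in_range])
          (use s_small in \<open>simp_all add: s_def\<close>)
      show "(1 - B / \<tau>) * dc i - dc i ^ 3 / (6 * \<tau>\<^sup>2) \<le> \<bar>s\<bar>"
        unfolding dc_def s_def by (rule tangent_inner_ge[OF orthogonal[OF x] orthogonal[OF xi] tube[OF x]])
    qed
    \<comment> \<open>The error term explains the leading 4 of the claim; \<open>m\<close> is at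
      most either of the other two entries of the maximum.\<close>
    also have "\<dots> \<le> (3 - 2 * q) * e + 4 * m * err" using s by (simp add: algebra_simps)
    also have "\<dots> \<le> 4 * max 2 (max (len + 2 * B) \<tau>) * e + 4 * max 2 (max (len + 2 * B) \<tau>) * err"
    proof (intro add_mono mult_right_mono)
      have "3 - 2 * q \<le> 4 * 2" using B(3) by simp
      also have "\<dots> \<le> 4 * max 2 (max (len + 2 * B) \<tau>)" by (intro mult_left_mono) auto
      finally show "3 - 2 * q \<le> 4 * max 2 (max (len + 2 * B) \<tau>)" .
    qed (use dc0[of i_curve] err0 in \<open>auto simp: e_def m_def L_def\<close>)
    also have "\<dots> = 4 * max 2 (max (len + 2 * B) \<tau>) * (e + err)" by (simp add: distrib_left)
    finally show ?thesis by (simp add: dc_def e_def i_def)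
  qed
qed

end
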